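(* Let $X_1,\ldots,X_n,Y_1,\ldots,Y_n$ be random variables with distributions $F_1,\ldots,F_n,G_1,\ldots,G_n$ respectively, all from the class $\mathcal{D}\cap\mathcal{L}$, which are generalized tail asymptotically independent (GTAI). Let $\Theta$ be a non-negative random variable with support bounded from above and $\mathbf{P}[\Theta=0]<1$, independent of $X_1,\ldots,X_n,Y_1,\ldots,Y_n$, and suppose $(X_k,Y_l)\in(\mathcal{D}\cap\mathcal{L})^{(2)}$ for all $k,l=1,\ldots,n$. Suppose further that $X_1,\ldots,X_n$ are tail asymptotically independent (TAI) and $Y_1,\ldots,Y_n$ are TAI. Put $S_i(\Theta)=\sum_{k=1}^i\Theta X_k$ and $T_j(\Theta)=\sum_{l=1}^j\Theta Y_l$. Then, as $x\wedge y\to\infty$, $$\mathbf{P}[S_n(\Theta)>x,\ T_n(\Theta)>y]\sim\mathbf{P}\Big[\max_{1\le i\le n}S_i(\Theta)>x,\ \max_{1\le j\le n}T_j(\Theta)>y\Big]\sim\mathbf{P}\Big[\max_{1\le k\le n}\Theta X_k>x,\ \max_{1\le l\le n}\Theta Y_l>y\Big]\sim\sum_{k=1}^n\sum_{l=1}^n\mathbf{P}[\Theta X_k>x,\ \Theta Y_l>y].$$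
   Context: Notation: $x\wedge y=\min\{x,y\}$; $f(x,y)\sim g(x,y)$ as $x\wedge y\to\infty$ means $\lim_{x\wedge y\to\infty} f(x,y)/g(x,y)=1$. For a distribution $F$ on $\mathbb{R}$, $\overline F=1-F$; the distributions $F_k,G_l$ have tails positive on $[0,\infty)$. Joint tails appearing in denominators or as conditioning events are implicitly assumed positive. One-dimensional classes: $F\in\mathcal{L}$ (long-tailed) if $\lim_{x\to\infty}\overline F(x-a)/\overline F(x)=1$ for every $a>0$. $F\in\mathcal{D}$ (dominatedly varying) if $\limsup_{x\to\infty}\overline F(bx)/\overline F(x)<\infty$ for some (equivalently all) $b\in(0,1)$. Two-dimensional classes: let $(X,Y)$ have marginal distributions $F,G$. We write $(X,Y)\in\mathcal{L}^{(2)}$ if $F,G\in\mathcal{L}$ and $\lim_{x\wedge y\to\infty}\mathbf{P}[X>x-a_1,Y>y-a_2]/\mathbf{P}[X>x,Y>y]=1$ for every $(a_1,a_2)\in[0,\infty)^2\setminus\{(0,0)\}$. We write $(X,Y)\in\mathcal{D}^{(2)}$ if $F,G\in\mathcal{D}$ and $\limsup_{x\wedge y\to\infty}\mathbf{P}[X>b_1x,Y>b_2y]/\mathbf{P}[X>x,Y>y]<\infty$ for some (equivalently all) $(b_1,b_2)\in(0,1)^2$. Finally $(\mathcal{D}\cap\mathcal{L})^{(2)}=\mathcal{D}^{(2)}\cap\mathcal{L}^{(2)}$. GTAI: $X_1,\ldots,X_n,Y_1,\ldots,Y_m$ are GTAI if (1) $\lim_{\min\{x_i,x_k,y_j\}\to\infty}\mathbf{P}[|X_i|>x_i\mid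 X_k>x_k,Y_j>y_j]=0$ for all $1\le i\ne k\le n$, $1\le j\le m$; and (2) $\lim_{\min\{x_i,y_k,y_j\}\to\infty}\mathbf{P}[|Y_j|>y_j\mid X_i>x_i,Y_k>y_k]=0$ for all $1\le j\ne k\le m$, $1\le i\le n$. TAI: $X_1,\ldots,X_n$ are TAI if $\lim_{x_i\wedge x_j\to\infty}\mathbf{P}[|X_i|>x_i\mid X_j>x_j]=0$ for all $i\ne j$ in $\{1,\ldots,n\}$. *)

theory Defs
  imports "HOL-Probability.Probability" "HOL-Library.Landau_Symbols"
begin

text \<open>
  Limits for \<open>x \<and> y \<rightarrow> \<infinity>\<close> (and \<open>min {x, y, z} \<rightarrow> \<infinity>\<close>) are taken along products of
  \<^const>\<open>at_top\<close>; the next two lemmas confirm that this is convergence of the minimum to infinity.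
\<close>

lemma at_top_prod_eq_min:
  "(at_top \<times>\<^sub>F at_top :: (real \<times> real) filter) = filtercomap (\<lambda>(x, y). min x y) at_top"
proof -
  have "eventually P (at_top \<times>\<^sub>F at_top) \<longleftrightarrow> eventually P (filtercomap (\<lambda>(x, y). min x y) at_top)"
    for P :: "real \<times> real \<Rightarrow> bool"
  proof
    assume "eventually P (at_top \<times>\<^sub>F at_top)"
    then obtain N :: real where "\<forall>x\<ge>N. \<forall>y\<ge>N. P (x, y)"
      by (auto simp: eventually_prod_same eventually_at_top_linorder)
    then show "eventually P (filtercomap (\<lambda>(x, y). min x y) at_top)"
      by (auto simp: eventually_filtercomap_at_top_linorder)
  next
    assume "eventually P (filtercomap (\<lambda>(x, y). min x y) at_top)"
    then obtain N :: real where "\<forall>x\<ge>N. \<forall>y\<ge>N. P (x, y)"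
      by (auto simp: eventually_filtercomap_at_top_linorder)
    then show "eventually P (at_top \<times>\<^sub>F at_top)"
      unfolding eventually_prod_same
      by (intro exI [of _ "\<lambda>x. x \<ge> N"]) (auto simp: eventually_ge_at_top)
  qed
  then show ?thesis by (simp add: filter_eq_iff)
qed

lemma at_top_prod3_eq_min:
  "(at_top \<times>\<^sub>F at_top \<times>\<^sub>F at_top :: (real \<times> real \<times> real) filter)
     = filtercomap (\<lambda>(x, y, z). min x (min y z)) at_top"
proof -
  have "eventually P (at_top \<times>\<^sub>F (at_top \<times>\<^sub>F at_top))
      \<longleftrightarrow> eventually P (filtercomap (\<lambda>(x, y, z). min x (min y z)) at_top)"
    for P :: "real \<times> real \<times> real \<Rightarrow> bool"
  proof
    assume "eventually P (at_top \<times>\<^sub>F (at_top \<times>\<^sub>F at_top))"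
    then obtain Q R where "eventually Q at_top" and R: "eventually R (at_top \<times>\<^sub>F at_top)"
      and P: "\<And>x yz. Q x \<Longrightarrow> R yz \<Longrightarrow> P (x, yz)"
      unfolding eventually_prod_filter [of P] by blast
    then obtain N where N: "\<forall>x\<ge>N. Q x"
      by (auto simp: eventually_at_top_linorder)
    obtain K where K: "\<forall>y\<ge>K. \<forall>z\<ge>K. R (y, z)"
      using R unfolding at_top_prod_eq_min
      by (auto simp: eventually_filtercomap_at_top_linorder)
    show "eventually P (filtercomap (\<lambda>(x, y, z). min x (min y z)) at_top)"
      unfolding eventually_filtercomap_at_top_linorder
      using N K P by (intro exI [of _ "max N K"]) auto
  next
    assume "eventually P (filtercomap (\<lambda>(x, y, z). min x (min y z)) at_top)"
    then obtain N where N: "\<forall>x\<ge>N. \<forall>y\<ge>N. \<forall>z\<ge>N. P (x, y, z)"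
      by (auto simp: eventually_filtercomap_at_top_linorder)
    have "eventually (\<lambda>(y, z). y \<ge> N \<and> z \<ge> N) (at_top \<times>\<^sub>F at_top)"
      unfolding at_top_prod_eq_min by (auto simp: eventually_filtercomap_at_top_linorder)
    then show "eventually P (at_top \<times>\<^sub>F (at_top \<times>\<^sub>F at_top))"
      unfolding eventually_prod_filter [of P]
      using N by (intro exI [of _ "\<lambda>x. x \<ge> N"] exI [of _ "\<lambda>(y, z). y \<ge> N \<and> z \<ge> N"])
        (auto simp: eventually_ge_at_top)
  qed
  then show ?thesis by (simp add: filter_eq_iff)
qed

text \<open>One-dimensional distributions are probability measures on the reals.\<close>

definition tail :: "real measure \<Rightarrow> real \<Rightarrow> real" where
  "tail F x = 1 - cdf F x"

definition long_tailed :: "real measure \<Rightarrow> bool" where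
  "long_tailed F \<longleftrightarrow> (\<forall>a>0. ((\<lambda>x. tail F (x - a) / tail F x) \<longlongrightarrow> 1) at_top)"

text \<open>
  Since \<open>x / 0 = 0\<close>, the two definitions of dominated variation below are meaningful only for
  distributions whose (joint) tails are positive; users have to assume this separately.
\<close>

definition dominatedly_varying :: "real measure \<Rightarrow> bool" where
  "dominatedly_varying F \<longleftrightarrow>
     (\<exists>b\<in>{0<..<1}. Limsup at_top (\<lambda>x. ereal (tail F (b * x) / tail F x)) < \<infinity>)"

definition joint_tail :: "'a measure \<Rightarrow> ('a \<Rightarrow> real) \<Rightarrow> ('a \<Rightarrow> real) \<Rightarrow> real \<Rightarrow> real \<Rightarrow> real" where
  "joint_tail M X Y x y = \<P>(\<omega> in M. X \<omega> > x \<and> Y \<omega> > y)"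

definition long_tailed2 :: "'a measure \<Rightarrow> ('a \<Rightarrow> real) \<Rightarrow> ('a \<Rightarrow> real) \<Rightarrow> bool" where
  "long_tailed2 M X Y \<longleftrightarrow>
     long_tailed (distr M borel X) \<and> long_tailed (distr M borel Y) \<and>
     (\<forall>a1\<ge>0. \<forall>a2\<ge>0. (a1, a2) \<noteq> (0, 0) \<longrightarrow>
        ((\<lambda>(x, y). joint_tail M X Y (x - a1) (y - a2) / joint_tail M X Y x y) \<longlongrightarrow> 1)
          (at_top \<times>\<^sub>F at_top))"

definition dominatedly_varying2 :: "'a measure \<Rightarrow> ('a \<Rightarrow> real) \<Rightarrow> ('a \<Rightarrow> real) \<Rightarrow> bool" where
  "dominatedly_varying2 M X Y \<longleftrightarrow>
     dominatedly_varying (distr M borel X) \<and> dominatedly_varying (distr M borel Y) \<and>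
     (\<exists>b1\<in>{0<..<1}. \<exists>b2\<in>{0<..<1}.
        Limsup (at_top \<times>\<^sub>F at_top)
          (\<lambda>(x, y). ereal (joint_tail M X Y (b1 * x) (b2 * y) / joint_tail M X Y x y)) < \<infinity>)"

definition GTAI ::
  "'a measure \<Rightarrow> nat \<Rightarrow> nat \<Rightarrow> (nat \<Rightarrow> 'a \<Rightarrow> real) \<Rightarrow> (nat \<Rightarrow> 'a \<Rightarrow> real) \<Rightarrow> bool" where
  "GTAI M n m X Y \<longleftrightarrow>
     (\<forall>i\<in>{1..n}. \<forall>k\<in>{1..n}. \<forall>j\<in>{1..m}. i \<noteq> k \<longrightarrow>
        ((\<lambda>(xi, xk, yj). \<P>(\<omega> in M. \<bar>X i \<omega>\<bar> > xi \<bar> X k \<omega> > xk \<and> Y j \<omega> > yj)) \<longlongrightarrow> 0)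
          (at_top \<times>\<^sub>F at_top \<times>\<^sub>F at_top)) \<and>
     (\<forall>j\<in>{1..m}. \<forall>k\<in>{1..m}. \<forall>i\<in>{1..n}. j \<noteq> k \<longrightarrow>
        ((\<lambda>(xi, yk, yj). \<P>(\<omega> in M. \<bar>Y j \<omega>\<bar> > yj \<bar> X i \<omega> > xi \<and> Y k \<omega> > yk)) \<longlongrightarrow> 0)
          (at_top \<times>\<^sub>F at_top \<times>\<^sub>F at_top))"

definition TAI :: "'a measure \<Rightarrow> nat \<Rightarrow> (nat \<Rightarrow> 'a \<Rightarrow> real) \<Rightarrow> bool" where
  "TAI M n X \<longleftrightarrow>
     (\<forall>i\<in>{1..n}. \<forall>j\<in>{1..n}. i \<noteq> j \<longrightarrow>
        ((\<lambda>(xi, xj). \<P>(\<omega> in M. \<bar>X i \<omega>\<bar> > xi \<bar> X j \<omega> > xj)) \<longlongrightarrow> 0)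
          (at_top \<times>\<^sub>F at_top))"

definition measure_support :: "'a::topological_space measure \<Rightarrow> 'a set" where
  "measure_support \<mu> = {x. \<forall>U. open U \<and> x \<in> U \<longrightarrow> emeasure \<mu> U > 0}"

text \<open>
  Independence of two random elements with values in possibly different types, for which
  \<open>indep_var\<close> is too restrictive: independence of the generated \<open>\<sigma>\<close>-algebras.
\<close>

definition indep_elements ::
  "'a measure \<Rightarrow> 'b measure \<Rightarrow> ('a \<Rightarrow> 'b) \<Rightarrow> 'c measure \<Rightarrow> ('a \<Rightarrow> 'c) \<Rightarrow> bool" where
  "indep_elements M N1 Z1 N2 Z2 \<longleftrightarrow>
     prob_space.indep_set M
       {Z1 -` A \<inter> space M | A. A \<in> sets N1}
       {Z2 -` A \<inter> space M | A. A \<in> sets N2}"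

definition weighted_sum :: "('a \<Rightarrow> real) \<Rightarrow> (nat \<Rightarrow> 'a \<Rightarrow> real) \<Rightarrow> nat \<Rightarrow> 'a \<Rightarrow> real" where
  "weighted_sum \<Theta> X i \<omega> = (\<Sum>k=1..i. \<Theta> \<omega> * X k \<omega>)"

end

theory Submission
  imports Defs
begin

text \<open>
  All three probabilities are compared with the double sum on the right, and all three for the same
  reason: the principle of a single big jump, applied in each of the two coordinates.

  Leave the factor \<open>\<Theta>\<close> aside for the moment. The sum \<open>S\<^sub>n\<close>, the maximum of the partial sums and the
  maximum of the terms all lie between \<open>X k - (\<Sum>i\<noteq>k. \<bar>X i\<bar>)\<close>, for any \<open>k\<close>, and the sum of the
  positive parts. For any pair of functionals with these bounds, the probability of exceeding
  \<open>(x, y)\<close> is equivalent to \<open>\<Sum>k l. P[X k > x, Y l > y]\<close> (lemma \<open>joint_tail_squeezed\<close>).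
  From above: if the sums of positive parts exceed \<open>x\<close> and \<open>y\<close>, let \<open>X k\<close> and \<open>Y l\<close> be largest terms.
  Either the remaining terms are all below a fixed level \<open>b\<close>, so that \<open>X k > x - n b\<close> and
  \<open>Y l > y - n b\<close>, and the shift is harmless for long tails; or \<open>X k > x / n\<close>, \<open>Y l > y / n\<close> and
  a third variable exceeds \<open>b\<close>. By generalized tail asymptotic independence the
  latter has probability at most a small multiple of \<open>P[X k > x / n, Y l > y / n]\<close>, which dominated
  variation compares with \<open>P[X k > x, Y l > y]\<close> (lemma \<open>big_jump_upper\<close>). From below: the
  events that \<open>X k > x + n b\<close>, \<open>Y l > y + n b\<close> and all other variables are at most \<open>b\<close> in absolute
  value are disjoint for different pairs \<open>(k, l)\<close>, force both functionals to be large, and have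
  probability close to \<open>P[X k > x, Y l > y]\<close> (lemma \<open>big_jump_lower\<close>).

  The factor is treated by conditioning on \<open>\<Theta> = \<theta>\<close>, which by independence replaces \<open>(x, y)\<close> by
  \<open>(x / \<theta>, y / \<theta>)\<close>. Since \<open>\<Theta>\<close> is bounded, these levels tend to infinity uniformly in \<open>\<theta>\<close>, so the
  relative error bound can be integrated over the law of \<open>\<Theta>\<close>
  (lemma \<open>asymp_equiv_joint_tail_scale_mixture\<close>).
\<close>

section \<open>Limits in two and three variables\<close>

lemma eventually_at_top_prod:
  fixes P :: "real \<times> real \<Rightarrow> bool"
  shows "eventually P (at_top \<times>\<^sub>F at_top) \<longleftrightarrow> (\<exists>N. \<forall>x\<ge>N. \<forall>y\<ge>N. P (x, y))"
  unfolding at_top_prod_eq_min by (auto simp: eventually_filtercomap_at_top_linorder)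

lemma eventually_at_top_prod3:
  fixes P :: "real \<times> real \<times> real \<Rightarrow> bool"
  shows "eventually P (at_top \<times>\<^sub>F at_top \<times>\<^sub>F at_top) \<longleftrightarrow>
    (\<exists>N. \<forall>x\<ge>N. \<forall>y\<ge>N. \<forall>z\<ge>N. P (x, y, z))"
  unfolding at_top_prod3_eq_min by (auto simp: eventually_filtercomap_at_top_linorder)

text \<open>
  The form in which asymptotic equivalence is produced and consumed below: a relative error bound
  is stable under integration and makes sense where both sides vanish.
\<close>

lemma asymp_equiv_iff_relative_error:
  fixes f g :: "'a \<Rightarrow> real"
  assumes "\<And>x. g x \<ge> 0"
  shows "f \<sim>[A] g \<longleftrightarrow> (\<forall>e>0. \<forall>\<^sub>F x in A. \<bar>f x - g x\<bar> \<le> e * g x)"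
  using assms by (simp add: asymp_equiv_altdef smallo_def)

section \<open>Joint tails under scaling and shifting\<close>

lemma joint_tail_nonneg: "joint_tail M U V x y \<ge> 0"
  by (simp add: joint_tail_def)

lemma (in prob_space) joint_tail_antimono:
  assumes "U \<in> borel_measurable M" "V \<in> borel_measurable M" "x' \<le> x" "y' \<le> y"
  shows "joint_tail M U V x y \<le> joint_tail M U V x' y'"
  unfolding joint_tail_def using assms by (intro finite_measure_mono) auto

lemma joint_tail_cong_AE:
  assumes "U \<in> borel_measurable M" "V \<in> borel_measurable M"
    "U' \<in> borel_measurable M" "V' \<in> borel_measurable M"
    and "AE \<omega> in M. U \<omega> = U' \<omega> \<and> V \<omega> = V' \<omega>"
  shows "joint_tail M U V x y = joint_tail M U' V' x y"
  unfolding joint_tail_def using assms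
  by (intro measure_eq_AE) auto

text \<open>
  Dominated variation provides one pair of contraction factors; iterating it reaches arbitrarily
  small factors, and monotonicity of the tail then gives all of them.
\<close>

lemma (in prob_space) dominatedly_varying2_scale:
  assumes meas: "U \<in> borel_measurable M" "V \<in> borel_measurable M"
    and pos: "\<And>x y. x \<ge> 0 \<Longrightarrow> y \<ge> 0 \<Longrightarrow> joint_tail M U V x y > 0"
    and dv: "dominatedly_varying2 M U V"
    and c: "c1 > 0" "c2 > 0"
  shows "\<exists>C>0. \<forall>\<^sub>F (x, y) in at_top \<times>\<^sub>F at_top.
           joint_tail M U V (c1 * x) (c2 * y) \<le> C * joint_tail M U V x y"
proof -
  let ?J = "joint_tail M U V"
  obtain b1 b2 where b: "0 < b1" "b1 < 1" "0 < b2" "b2 < 1"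
    and L: "Limsup (at_top \<times>\<^sub>F at_top) (\<lambda>(x, y). ereal (?J (b1 * x) (b2 * y) / ?J x y)) < \<infinity>"
    using dv by (auto simp: dominatedly_varying2_def)
  obtain k :: nat where
    "Limsup (at_top \<times>\<^sub>F at_top) (\<lambda>(x, y). ereal (?J (b1 * x) (b2 * y) / ?J x y)) < ereal (real k)"
    using less_PInf_Ex_of_nat L by auto
  then have "\<forall>\<^sub>F (x, y) in at_top \<times>\<^sub>F at_top. ereal (?J (b1 * x) (b2 * y) / ?J x y) < ereal (real k)"
    by (auto dest!: Limsup_lessD simp: case_prod_beta')
  then obtain N0 where N0: "\<And>x y. x \<ge> N0 \<Longrightarrow> y \<ge> N0 \<Longrightarrow> ?J (b1 * x) (b2 * y) / ?J x y < real k"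
    by (auto simp: eventually_at_top_prod)
  define N where "N = max 0 N0"
  define K where "K = max 1 (real k)"
  have K: "K > 0" by (simp add: K_def)
  have one_step: "?J (b1 * x) (b2 * y) \<le> K * ?J x y" if "x \<ge> N" "y \<ge> N" for x y
  proof -
    have "?J x y > 0" using that pos by (simp add: N_def)
    moreover have "?J (b1 * x) (b2 * y) / ?J x y \<le> K"
      using N0[of x y] that by (simp add: N_def K_def)
    ultimately show ?thesis by (simp add: pos_divide_le_eq)
  qed
  have iterate: "\<exists>R. \<forall>x\<ge>R. \<forall>y\<ge>R. ?J (b1 ^ j * x) (b2 ^ j * y) \<le> K ^ j * ?J x y" for j
  proof (induction j)
    case 0
    show ?case by simp
  next
    case (Suc j)
    then obtain R where R: "\<And>x y. x \<ge> R \<Longrightarrow> y \<ge> R \<Longrightarrow>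
        ?J (b1 ^ j * x) (b2 ^ j * y) \<le> K ^ j * ?J x y" by blast
    show ?case
    proof (intro exI[of _ "max R (max (N / b1 ^ j) (N / b2 ^ j))"] allI impI)
      fix x y assume xy: "x \<ge> max R (max (N / b1 ^ j) (N / b2 ^ j))"
        "y \<ge> max R (max (N / b1 ^ j) (N / b2 ^ j))"
      have "N \<le> b1 ^ j * x" "N \<le> b2 ^ j * y"
        using xy b by (simp_all add: pos_divide_le_eq mult.commute)
      from one_step[OF this]
      have "?J (b1 ^ Suc j * x) (b2 ^ Suc j * y) \<le> K * ?J (b1 ^ j * x) (b2 ^ j * y)"
        by (simp add: mult.assoc)
      also have "\<dots> \<le> K * (K ^ j * ?J x y)"
        using R[of x y] xy K by (intro mult_left_mono) auto
      finally show "?J (b1 ^ Suc j * x) (b2 ^ Suc j * y) \<le> K ^ Suc j * ?J x y"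
        by (simp add: mult.assoc)
    qed
  qed
  obtain j1 where j1: "b1 ^ j1 < c1" using real_arch_pow_inv b c by blast
  obtain j2 where j2: "b2 ^ j2 < c2" using real_arch_pow_inv b c by blast
  define j where "j = max j1 j2"
  have "b1 ^ j \<le> b1 ^ j1" "b2 ^ j \<le> b2 ^ j2"
    using b by (auto simp: j_def intro!: power_decreasing)
  with j1 j2 have small: "b1 ^ j \<le> c1" "b2 ^ j \<le> c2" by auto
  obtain R where R: "\<And>x y. x \<ge> R \<Longrightarrow> y \<ge> R \<Longrightarrow>
        ?J (b1 ^ j * x) (b2 ^ j * y) \<le> K ^ j * ?J x y" using iterate by blast
  have "?J (c1 * x) (c2 * y) \<le> K ^ j * ?J x y" if "x \<ge> max 0 R" "y \<ge> max 0 R" for x y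
  proof -
    have "?J (c1 * x) (c2 * y) \<le> ?J (b1 ^ j * x) (b2 ^ j * y)"
      using that small by (intro joint_tail_antimono meas mult_right_mono) auto
    also have "\<dots> \<le> K ^ j * ?J x y" using R that by auto
    finally show ?thesis .
  qed
  then show ?thesis
    using K by (intro exI[of _ "K ^ j"] conjI) (auto simp: eventually_at_top_prod intro!: exI[of _ "max 0 R"])
qed

lemma long_tailed2_shift_down:
  assumes pos: "\<And>x y. x \<ge> 0 \<Longrightarrow> y \<ge> 0 \<Longrightarrow> joint_tail M U V x y > 0"
    and lt: "long_tailed2 M U V" and a: "a1 \<ge> 0" "a2 \<ge> 0" and e: "e > 0"
  shows "\<forall>\<^sub>F (x, y) in at_top \<times>\<^sub>F at_top.
           joint_tail M U V (x - a1) (y - a2) \<le> (1 + e) * joint_tail M U V x y"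
proof (cases "a1 = 0 \<and> a2 = 0")
  case True
  with e show ?thesis
    by (auto simp: distrib_right joint_tail_nonneg intro!: always_eventually)
next
  case False
  let ?J = "joint_tail M U V"
  have "((\<lambda>(x, y). ?J (x - a1) (y - a2) / ?J x y) \<longlongrightarrow> 1) (at_top \<times>\<^sub>F at_top)"
    using lt a False unfolding long_tailed2_def by blast
  then have "\<forall>\<^sub>F (x, y) in at_top \<times>\<^sub>F at_top. ?J (x - a1) (y - a2) / ?J x y < 1 + e"
    using e by (auto simp: case_prod_beta' dest!: order_tendstoD(2)[where a = "1 + e"])
  then obtain N where N: "\<And>x y. x \<ge> N \<Longrightarrow> y \<ge> N \<Longrightarrow> ?J (x - a1) (y - a2) / ?J x y < 1 + e"
    by (auto simp: eventually_at_top_prod)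
  have "?J (x - a1) (y - a2) \<le> (1 + e) * ?J x y" if "x \<ge> max 0 N" "y \<ge> max 0 N" for x y
    using N[of x y] pos[of x y] that by (simp add: pos_divide_less_eq less_imp_le)
  then show ?thesis unfolding eventually_at_top_prod prod.case by blast
qed

text \<open>
  Shifting the arguments down by \<open>(a\<^sub>1, a\<^sub>2)\<close> at the point \<open>(x + a\<^sub>1, y + a\<^sub>2)\<close> leads back to \<open>(x, y)\<close>;
  inverting the factor \<open>1 + e\<close> costs only \<open>(1 - e) (1 + e) \<le> 1\<close>.
\<close>

lemma long_tailed2_shift_up:
  assumes pos: "\<And>x y. x \<ge> 0 \<Longrightarrow> y \<ge> 0 \<Longrightarrow> joint_tail M U V x y > 0"
    and lt: "long_tailed2 M U V" and a: "a1 \<ge> 0" "a2 \<ge> 0" and e: "e > 0"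
  shows "\<forall>\<^sub>F (x, y) in at_top \<times>\<^sub>F at_top.
           joint_tail M U V (x + a1) (y + a2) \<ge> (1 - e) * joint_tail M U V x y"
proof -
  let ?J = "joint_tail M U V"
  obtain N where N: "\<And>x y. x \<ge> N \<Longrightarrow> y \<ge> N \<Longrightarrow> ?J (x - a1) (y - a2) \<le> (1 + e) * ?J x y"
    using long_tailed2_shift_down[OF assms] by (auto simp: eventually_at_top_prod)
  have "(1 - e) * ?J x y \<le> ?J (x + a1) (y + a2)" if "x \<ge> N" "y \<ge> N" for x y
  proof -
    show ?thesis
    proof (cases "e \<ge> 1")
      case True
      then have "(1 - e) * ?J x y \<le> 0"
        using joint_tail_nonneg[of M U V x y] by (simp add: mult_nonpos_nonneg)
      then show ?thesis using joint_tail_nonneg[of M U V "x + a1" "y + a2"] by linarith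
    next
      case False
      then have "(1 - e) * ?J x y \<le> (1 - e) * ((1 + e) * ?J (x + a1) (y + a2))"
        using N[of "x + a1" "y + a2"] that a by (intro mult_left_mono) auto
      also have "\<dots> = ((1 - e) * (1 + e)) * ?J (x + a1) (y + a2)" by simp
      also have "\<dots> \<le> 1 * ?J (x + a1) (y + a2)"
        by (intro mult_right_mono joint_tail_nonneg) (simp add: algebra_simps)
      finally show ?thesis by simp
    qed
  qed
  then show ?thesis by (auto simp: eventually_at_top_prod)
qed

section \<open>A single big jump in each coordinate\<close>

text \<open>
  The index \<open>k\<close> is that of a largest term. It exceeds the average, and if every other term is at
  most \<open>b\<close> it makes up all of the sum but a bounded amount.
\<close>

lemma sum_pos_parts_gt_cases:
  fixes f :: "'i \<Rightarrow> real" and b :: real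
  assumes "finite A" "x \<ge> 0" "b \<ge> 0" "(\<Sum>k\<in>A. max 0 (f k)) > x"
  obtains k where "k \<in> A" "f k > x / card A"
    "f k > x - card A * b \<or> (\<exists>i\<in>A - {k}. f i > b)"
proof -
  have "A \<noteq> {}" using assms by auto
  then have "Max (f ` A) \<in> f ` A" using assms(1) by (intro Max_in) auto
  then obtain k where k: "k \<in> A" and "f k = Max (f ` A)" by auto
  then have mx: "\<And>i. i \<in> A \<Longrightarrow> f i \<le> f k" using assms(1) by simp
  have fk: "f k > 0"
  proof (rule ccontr)
    assume "\<not> f k > 0"
    then have "(\<Sum>k\<in>A. max 0 (f k)) = 0"
      using mx by (intro sum.neutral ballI) (force simp: max_def)
    with assms show False by simp
  qed
  have cA: "card A > 0" using assms \<open>A \<noteq> {}\<close> by (simp add: card_gt_0_iff)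
  have "(\<Sum>i\<in>A. max 0 (f i)) \<le> card A * f k"
    using mx fk by (intro sum_bounded_above) auto
  with assms have "x < card A * f k" by linarith
  then have big: "f k > x / card A" using cA by (simp add: pos_divide_less_eq mult.commute)
  have "f k > x - card A * b" if "\<not> (\<exists>i\<in>A - {k}. f i > b)"
  proof -
    have "(\<Sum>i\<in>A - {k}. max 0 (f i)) \<le> real (card (A - {k})) * b"
      using that assms by (intro sum_bounded_above) (auto simp: not_less)
    also have "\<dots> \<le> real (card A) * b"
      using assms by (intro mult_right_mono) (auto intro: card_mono)
    finally show ?thesis
      using assms k fk by (simp add: sum.remove)
  qed
  with that k big show ?thesis by blast
qed

text \<open>
  The two families before the random factor is introduced. The positivity assumption keeps the
  quotients in the definitions of the tail classes and the conditional probabilities from degenerating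
  to the default value of a division by zero.
\<close>

locale gtai_vectors = prob_space M for M :: "'a measure" +
  fixes X Y :: "nat \<Rightarrow> 'a \<Rightarrow> real" and n m :: nat
  assumes X_measurable [measurable]: "k \<in> {1..n} \<Longrightarrow> X k \<in> borel_measurable M"
    and Y_measurable [measurable]: "l \<in> {1..m} \<Longrightarrow> Y l \<in> borel_measurable M"
    and joint_tail_pos: "\<lbrakk>k \<in> {1..n}; l \<in> {1..m}; x \<ge> 0; y \<ge> 0\<rbrakk>
          \<Longrightarrow> joint_tail M (X k) (Y l) x y > 0"
    and gtai: "GTAI M n m X Y"
    and dominated: "\<lbrakk>k \<in> {1..n}; l \<in> {1..m}\<rbrakk> \<Longrightarrow> dominatedly_varying2 M (X k) (Y l)"
    and long: "\<lbrakk>k \<in> {1..n}; l \<in> {1..m}\<rbrakk> \<Longrightarrow> long_tailed2 M (X k) (Y l)"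
begin

lemma X_exceedance_negligible:
  assumes k: "k \<in> {1..n}" and i: "i \<in> {1..n}" "i \<noteq> k" and l: "l \<in> {1..m}" and e: "e > 0"
  shows "\<exists>N. \<forall>u\<ge>N. \<forall>v\<ge>N. \<forall>w\<ge>N.
    \<P>(\<omega> in M. \<bar>X i \<omega>\<bar> > u \<and> X k \<omega> > v \<and> Y l \<omega> > w) \<le> e * joint_tail M (X k) (Y l) v w"
proof -
  have "((\<lambda>(u, v, w). \<P>(\<omega> in M. \<bar>X i \<omega>\<bar> > u \<bar> X k \<omega> > v \<and> Y l \<omega> > w)) \<longlongrightarrow> 0)
          (at_top \<times>\<^sub>F at_top \<times>\<^sub>F at_top)"
    using gtai assms unfolding GTAI_def by blast
  from order_tendstoD(2)[OF this e] obtain N where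
    N: "\<And>u v w. u \<ge> N \<Longrightarrow> v \<ge> N \<Longrightarrow> w \<ge> N \<Longrightarrow>
          \<P>(\<omega> in M. \<bar>X i \<omega>\<bar> > u \<bar> X k \<omega> > v \<and> Y l \<omega> > w) < e"
    by (auto simp: eventually_at_top_prod3 case_prod_beta)
  have "\<P>(\<omega> in M. \<bar>X i \<omega>\<bar> > u \<and> X k \<omega> > v \<and> Y l \<omega> > w) \<le> e * joint_tail M (X k) (Y l) v w"
    if "u \<ge> max 0 N" "v \<ge> max 0 N" "w \<ge> max 0 N" for u v w
    using N[of u v w] joint_tail_pos[OF k l, of v w] that
    by (simp add: cond_prob_def joint_tail_def pos_divide_less_eq)
  then show ?thesis by blast
qed

lemma Y_exceedance_negligible:
  assumes k: "k \<in> {1..n}" and l: "l \<in> {1..m}" and j: "j \<in> {1..m}" "j \<noteq> l" and e: "e > 0"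
  shows "\<exists>N. \<forall>u\<ge>N. \<forall>v\<ge>N. \<forall>w\<ge>N.
    \<P>(\<omega> in M. \<bar>Y j \<omega>\<bar> > u \<and> X k \<omega> > v \<and> Y l \<omega> > w) \<le> e * joint_tail M (X k) (Y l) v w"
proof -
  have "((\<lambda>(v, w, u). \<P>(\<omega> in M. \<bar>Y j \<omega>\<bar> > u \<bar> X k \<omega> > v \<and> Y l \<omega> > w)) \<longlongrightarrow> 0)
          (at_top \<times>\<^sub>F at_top \<times>\<^sub>F at_top)"
    using gtai assms unfolding GTAI_def by blast
  from order_tendstoD(2)[OF this e] obtain N where
    N: "\<And>u v w. u \<ge> N \<Longrightarrow> v \<ge> N \<Longrightarrow> w \<ge> N \<Longrightarrow>
          \<P>(\<omega> in M. \<bar>Y j \<omega>\<bar> > u \<bar> X k \<omega> > v \<and> Y l \<omega> > w) < e"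
    by (auto simp: eventually_at_top_prod3 case_prod_beta)
  have "\<P>(\<omega> in M. \<bar>Y j \<omega>\<bar> > u \<and> X k \<omega> > v \<and> Y l \<omega> > w) \<le> e * joint_tail M (X k) (Y l) v w"
    if "u \<ge> max 0 N" "v \<ge> max 0 N" "w \<ge> max 0 N" for u v w
    using N[of u v w] joint_tail_pos[OF k l, of v w] that
    by (simp add: cond_prob_def joint_tail_def pos_divide_less_eq)
  then show ?thesis by blast
qed

text \<open>
  The event that the jumps at \<open>k\<close> and \<open>l\<close> are not the only big ones, at a level \<open>b\<close> that
  stays fixed while \<open>x\<close> and \<open>y\<close> grow.
\<close>

definition other_large :: "nat \<Rightarrow> nat \<Rightarrow> real \<Rightarrow> 'a set" where
  "other_large k l b = {\<omega> \<in> space M.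
     (\<exists>i\<in>{1..n} - {k}. \<bar>X i \<omega>\<bar> > b) \<or> (\<exists>j\<in>{1..m} - {l}. \<bar>Y j \<omega>\<bar> > b)}"

lemma other_large_sets [measurable]: "other_large k l b \<in> sets M"
  unfolding other_large_def by measurable

text \<open>
  Generalized tail asymptotic independence is uniform over the three levels once all of them are
  large; this is what allows the level \<open>b\<close> to be chosen first and then kept constant.
\<close>

lemma other_large_negligible:
  assumes k: "k \<in> {1..n}" and l: "l \<in> {1..m}" and e: "e > 0"
  shows "\<exists>N. \<forall>b\<ge>N. \<forall>v\<ge>N. \<forall>w\<ge>N.
    \<P>(\<omega> in M. \<omega> \<in> other_large k l b \<and> X k \<omega> > v \<and> Y l \<omega> > w)
      \<le> e * joint_tail M (X k) (Y l) v w"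
proof -
  define d where "d = e / (real n + real m)"
  have nm: "real n + real m > 0" using k by auto
  then have d: "d > 0" using e by (simp add: d_def)
  have "\<forall>i\<in>{1..n} - {k}. \<exists>N. \<forall>u\<ge>N. \<forall>v\<ge>N. \<forall>w\<ge>N.
    \<P>(\<omega> in M. \<bar>X i \<omega>\<bar> > u \<and> X k \<omega> > v \<and> Y l \<omega> > w) \<le> d * joint_tail M (X k) (Y l) v w"
    using X_exceedance_negligible[OF k _ _ l d] by blast
  from bchoice[OF this] obtain NX where NX: "\<And>i u v w. i \<in> {1..n} - {k} \<Longrightarrow>
      u \<ge> NX i \<Longrightarrow> v \<ge> NX i \<Longrightarrow> w \<ge> NX i \<Longrightarrow>
      \<P>(\<omega> in M. \<bar>X i \<omega>\<bar> > u \<and> X k \<omega> > v \<and> Y l \<omega> > w) \<le> d * joint_tail M (X k) (Y l) v w"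
    by blast
  have "\<forall>j\<in>{1..m} - {l}. \<exists>N. \<forall>u\<ge>N. \<forall>v\<ge>N. \<forall>w\<ge>N.
    \<P>(\<omega> in M. \<bar>Y j \<omega>\<bar> > u \<and> X k \<omega> > v \<and> Y l \<omega> > w) \<le> d * joint_tail M (X k) (Y l) v w"
    using Y_exceedance_negligible[OF k l _ _ d] by blast
  from bchoice[OF this] obtain NY where NY: "\<And>j u v w. j \<in> {1..m} - {l} \<Longrightarrow>
      u \<ge> NY j \<Longrightarrow> v \<ge> NY j \<Longrightarrow> w \<ge> NY j \<Longrightarrow>
      \<P>(\<omega> in M. \<bar>Y j \<omega>\<bar> > u \<and> X k \<omega> > v \<and> Y l \<omega> > w) \<le> d * joint_tail M (X k) (Y l) v w"
    by blast
  define N where "N = Max (NX ` {1..n} \<union> NY ` {1..m})"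
  have NXle: "NX i \<le> N" if "i \<in> {1..n}" for i
    using that unfolding N_def by (intro Max_ge) auto
  have NYle: "NY j \<le> N" if "j \<in> {1..m}" for j
    using that unfolding N_def by (intro Max_ge) auto
  show ?thesis
  proof (intro exI[of _ N] allI impI)
    fix b v w assume N: "N \<le> b" "N \<le> v" "N \<le> w"
    let ?J = "joint_tail M (X k) (Y l) v w"
    let ?AX = "\<lambda>i. {\<omega> \<in> space M. \<bar>X i \<omega>\<bar> > b \<and> X k \<omega> > v \<and> Y l \<omega> > w}"
    let ?AY = "\<lambda>j. {\<omega> \<in> space M. \<bar>Y j \<omega>\<bar> > b \<and> X k \<omega> > v \<and> Y l \<omega> > w}"
    note [measurable] = X_measurable[OF k] Y_measurable[OF l]
    have sX: "?AX ` ({1..n} - {k}) \<subseteq> events" by auto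
    have sY: "?AY ` ({1..m} - {l}) \<subseteq> events" by auto
    have "\<P>(\<omega> in M. \<omega> \<in> other_large k l b \<and> X k \<omega> > v \<and> Y l \<omega> > w)
       \<le> prob ((\<Union>i\<in>{1..n} - {k}. ?AX i) \<union> (\<Union>j\<in>{1..m} - {l}. ?AY j))"
      using sX sY by (intro finite_measure_mono) (auto simp: other_large_def)
    also have "\<dots> \<le> prob (\<Union>i\<in>{1..n} - {k}. ?AX i) + prob (\<Union>j\<in>{1..m} - {l}. ?AY j)"
      using sX sY by (intro measure_Un_le) auto
    also have "\<dots> \<le> (\<Sum>i\<in>{1..n} - {k}. prob (?AX i)) + (\<Sum>j\<in>{1..m} - {l}. prob (?AY j))"
      using sX sY by (intro add_mono finite_measure_subadditive_finite) auto
    also have "\<dots> \<le> card ({1..n} - {k}) * (d * ?J) + card ({1..m} - {l}) * (d * ?J)"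
    proof (intro add_mono sum_bounded_above)
      show "prob (?AX i) \<le> d * ?J" if "i \<in> {1..n} - {k}" for i
        using NX[OF that, of b v w] NXle[of i] that N by auto
      show "prob (?AY j) \<le> d * ?J" if "j \<in> {1..m} - {l}" for j
        using NY[OF that, of b v w] NYle[of j] that N by auto
    qed
    also have "\<dots> \<le> real n * (d * ?J) + real m * (d * ?J)"
      using d joint_tail_nonneg[of M "X k" "Y l" v w]
      card_Diff1_le[of "{1..n}" k] card_Diff1_le[of "{1..m}" l]
      by (intro add_mono mult_right_mono) auto
    also have "\<dots> = (d * (real n + real m)) * ?J" by (simp add: algebra_simps)
    also have "d * (real n + real m) = e" using nm by (simp add: d_def)
    finally show "\<P>(\<omega> in M. \<omega> \<in> other_large k l b \<and> X k \<omega> > v \<and> Y l \<omega> > w) \<le> e * ?J" .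
  qed
qed

text \<open>
  The two summands are the probabilities of the ways in which the sums of positive parts can
  become large with largest terms \<open>X k\<close> and \<open>Y l\<close>. If nothing else is large, both terms
  exceed their level up to a constant, which long-tailedness absorbs. Otherwise a third variable
  exceeds \<open>b\<close>, while the largest terms are only known to exceed \<open>x / n\<close> and \<open>y / m\<close>;
  dominated variation bounds the price of this rescaling by a constant, and generalized tail
  asymptotic independence outweighs that constant.
\<close>

lemma big_jump_upper:
  assumes k: "k \<in> {1..n}" and l: "l \<in> {1..m}" and e: "e > 0"
  shows "\<exists>B::real. \<forall>b\<ge>B. \<forall>\<^sub>F (x, y) in at_top \<times>\<^sub>F at_top.
    joint_tail M (X k) (Y l) (x - real n * b) (y - real m * b)
      + \<P>(\<omega> in M. \<omega> \<in> other_large k l b \<and> X k \<omega> > x / real n \<and> Y l \<omega> > y / real m)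
      \<le> (1 + e) * joint_tail M (X k) (Y l) x y"
proof -
  let ?J = "joint_tail M (X k) (Y l)"
  have n: "n > 0" "m > 0" using k l by auto
  then obtain C where C: "C > 0"
    and evC: "\<forall>\<^sub>F (x, y) in at_top \<times>\<^sub>F at_top. ?J (1 / n * x) (1 / m * y) \<le> C * ?J x y"
    using dominatedly_varying2_scale[OF X_measurable[OF k] Y_measurable[OF l]
        joint_tail_pos[OF k l] dominated[OF k l], of "1 / n" "1 / m"] by auto
  obtain NC where NC: "\<And>x y. x \<ge> NC \<Longrightarrow> y \<ge> NC \<Longrightarrow> ?J (x / real n) (y / real m) \<le> C * ?J x y"
    using evC by (auto simp: eventually_at_top_prod)
  obtain N where N: "\<And>b v w. b \<ge> N \<Longrightarrow> v \<ge> N \<Longrightarrow> w \<ge> N \<Longrightarrow>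
    \<P>(\<omega> in M. \<omega> \<in> other_large k l b \<and> X k \<omega> > v \<and> Y l \<omega> > w) \<le> (e / 2 / C) * ?J v w"
    using other_large_negligible[OF k l, of "e / 2 / C"] C e by auto
  show ?thesis
  proof (intro exI[of _ "max 0 N"] allI impI)
    fix b assume b: "b \<ge> max 0 N"
    obtain R where R: "\<And>x y. x \<ge> R \<Longrightarrow> y \<ge> R \<Longrightarrow>
        ?J (x - real n * b) (y - real m * b) \<le> (1 + e / 2) * ?J x y"
      using long_tailed2_shift_down[OF joint_tail_pos[OF k l] long[OF k l],
          of "n * b" "m * b" "e / 2"] b e by (auto simp: eventually_at_top_prod)
    show "\<forall>\<^sub>F (x, y) in at_top \<times>\<^sub>F at_top. ?J (x - real n * b) (y - real m * b)
      + \<P>(\<omega> in M. \<omega> \<in> other_large k l b \<and> X k \<omega> > x / real n \<and> Y l \<omega> > y / real m) \<le> (1 + e) * ?J x y"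
      unfolding eventually_at_top_prod prod.case
    proof (intro exI[of _ "max (max R NC) (max (n * N) (m * N))"] allI impI)
      fix x y assume xy: "max (max R NC) (max (n * N) (m * N)) \<le> x"
        "max (max R NC) (max (n * N) (m * N)) \<le> y"
      have "N \<le> x / real n" "N \<le> y / real m"
        using xy n by (simp_all add: pos_le_divide_eq mult.commute)
      with N b have "\<P>(\<omega> in M. \<omega> \<in> other_large k l b \<and> X k \<omega> > x / real n \<and> Y l \<omega> > y / real m)
          \<le> (e / 2 / C) * ?J (x / real n) (y / real m)" by auto
      also have "\<dots> \<le> (e / 2 / C) * (C * ?J x y)"
        using xy e C by (intro mult_left_mono NC) auto
      also have "\<dots> = e / 2 * ?J x y" using C by simp
      finally show "?J (x - real n * b) (y - real m * b)
      + \<P>(\<omega> in M. \<omega> \<in> other_large k l b \<and> X k \<omega> > x / real n \<and> Y l \<omega> > y / real m) \<le> (1 + e) * ?J x y"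
        using R[of x y] xy by (simp add: distrib_right)
    qed
  qed
qed

text \<open>
  The counterpart for a lower bound: overshooting by \<open>n * b\<close> and \<open>m * b\<close> compensates for
  all other terms when each of them is at most \<open>b\<close> in absolute value.
\<close>

lemma big_jump_lower:
  assumes k: "k \<in> {1..n}" and l: "l \<in> {1..m}" and e: "0 < e"
  shows "\<exists>B::real. \<forall>b\<ge>B. \<forall>\<^sub>F (x, y) in at_top \<times>\<^sub>F at_top.
    \<P>(\<omega> in M. \<omega> \<notin> other_large k l b \<and> X k \<omega> > x + real n * b \<and> Y l \<omega> > y + real m * b)
      \<ge> (1 - e) * joint_tail M (X k) (Y l) x y"
proof -
  let ?J = "joint_tail M (X k) (Y l)"
  note [measurable] = X_measurable[OF k] Y_measurable[OF l]
  obtain N where N: "\<And>b v w. b \<ge> N \<Longrightarrow> v \<ge> N \<Longrightarrow> w \<ge> N \<Longrightarrow>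
    \<P>(\<omega> in M. \<omega> \<in> other_large k l b \<and> X k \<omega> > v \<and> Y l \<omega> > w) \<le> e / 2 * ?J v w"
    using other_large_negligible[OF k l, of "e / 2"] e by auto
  show ?thesis
  proof (intro exI[of _ "max 0 N"] allI impI)
    fix b assume b: "b \<ge> max 0 N"
    obtain R where R: "\<And>x y. x \<ge> R \<Longrightarrow> y \<ge> R \<Longrightarrow>
        ?J (x + real n * b) (y + real m * b) \<ge> (1 - e / 2) * ?J x y"
      using long_tailed2_shift_up[OF joint_tail_pos[OF k l] long[OF k l],
          of "n * b" "m * b" "e / 2"] b e by (auto simp: eventually_at_top_prod)
    show "\<forall>\<^sub>F (x, y) in at_top \<times>\<^sub>F at_top.
      \<P>(\<omega> in M. \<omega> \<notin> other_large k l b \<and> X k \<omega> > x + real n * b \<and> Y l \<omega> > y + real m * b)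
        \<ge> (1 - e) * ?J x y"
      unfolding eventually_at_top_prod prod.case
    proof (intro exI[of _ "max R N"] allI impI)
      fix x y assume xy: "max R N \<le> x" "max R N \<le> y"
      let ?v = "x + real n * b" and ?w = "y + real m * b"
      have "real n * b \<ge> 0" "real m * b \<ge> 0" using b by auto
      then have vw: "?v \<ge> N" "?w \<ge> N" "?v \<ge> x" "?w \<ge> y" using xy by linarith+
      have split: "?J ?v ?w = \<P>(\<omega> in M. \<omega> \<in> other_large k l b \<and> X k \<omega> > ?v \<and> Y l \<omega> > ?w)
         + \<P>(\<omega> in M. \<omega> \<notin> other_large k l b \<and> X k \<omega> > ?v \<and> Y l \<omega> > ?w)"
        unfolding joint_tail_def
        by (subst finite_measure_Union[symmetric]) (auto intro!: arg_cong[where f = prob])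
      have "\<P>(\<omega> in M. \<omega> \<in> other_large k l b \<and> X k \<omega> > ?v \<and> Y l \<omega> > ?w) \<le> e / 2 * ?J ?v ?w"
        using N vw b by auto
      also have "\<dots> \<le> e / 2 * ?J x y"
        using e vw by (intro mult_left_mono joint_tail_antimono) auto
      finally show "(1 - e) * ?J x y \<le>
          \<P>(\<omega> in M. \<omega> \<notin> other_large k l b \<and> X k \<omega> > ?v \<and> Y l \<omega> > ?w)"
        using split R[of x y] xy by (simp add: algebra_simps)
    qed
  qed
qed


text \<open>
  The heart of the matter. The upper bound covers the event by the sets \<open>?up p\<close>, one for each
  pair of indices of largest terms. For the lower bound the sets \<open>?lo p\<close> lie inside the
  event and are pairwise disjoint, because the variable that is big in one of them is at most
  \<open>b\<close> in absolute value in another; so their probabilities add up without any correction term.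
\<close>

lemma joint_tail_squeezed:
  assumes U [measurable]: "U \<in> borel_measurable M" and V [measurable]: "V \<in> borel_measurable M"
    and U_le: "\<And>\<omega>. \<omega> \<in> space M \<Longrightarrow> U \<omega> \<le> (\<Sum>k=1..n. max 0 (X k \<omega>))"
    and V_le: "\<And>\<omega>. \<omega> \<in> space M \<Longrightarrow> V \<omega> \<le> (\<Sum>l=1..m. max 0 (Y l \<omega>))"
    and U_ge: "\<And>\<omega> k. \<omega> \<in> space M \<Longrightarrow> k \<in> {1..n} \<Longrightarrow>
                 X k \<omega> - (\<Sum>i\<in>{1..n} - {k}. \<bar>X i \<omega>\<bar>) \<le> U \<omega>"
    and V_ge: "\<And>\<omega> l. \<omega> \<in> space M \<Longrightarrow> l \<in> {1..m} \<Longrightarrow>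
                 Y l \<omega> - (\<Sum>j\<in>{1..m} - {l}. \<bar>Y j \<omega>\<bar>) \<le> V \<omega>"
  shows "(\<lambda>(x, y). joint_tail M U V x y) \<sim>[at_top \<times>\<^sub>F at_top]
         (\<lambda>(x, y). \<Sum>k=1..n. \<Sum>l=1..m. joint_tail M (X k) (Y l) x y)"
proof -
  define I where "I = {1..n} \<times> {1..m}"
  let ?J = "\<lambda>p. joint_tail M (X (fst p)) (Y (snd p))"
  have finI: "finite I" by (simp add: I_def)
  have XI [measurable]: "X (fst p) \<in> borel_measurable M" "Y (snd p) \<in> borel_measurable M"
    if "p \<in> I" for p using that by (auto simp: I_def)
  have sum_eq: "(\<Sum>k=1..n. \<Sum>l=1..m. joint_tail M (X k) (Y l) x y) = (\<Sum>p\<in>I. ?J p x y)" for x y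
    by (simp add: I_def sum.cartesian_product case_prod_beta)
  have "\<forall>\<^sub>F (x, y) in at_top \<times>\<^sub>F at_top.
      \<bar>joint_tail M U V x y - (\<Sum>p\<in>I. ?J p x y)\<bar> \<le> e * (\<Sum>p\<in>I. ?J p x y)" if e: "e > 0" for e
  proof -
    let ?up = "\<lambda>p b x y. {\<omega> \<in> space M. X (fst p) \<omega> > x - real n * b \<and> Y (snd p) \<omega> > y - real m * b}
      \<union> {\<omega> \<in> space M. \<omega> \<in> other_large (fst p) (snd p) b
            \<and> X (fst p) \<omega> > x / real n \<and> Y (snd p) \<omega> > y / real m}"
    let ?lo = "\<lambda>p b x y. {\<omega> \<in> space M. \<omega> \<notin> other_large (fst p) (snd p) b
            \<and> X (fst p) \<omega> > x + real n * b \<and> Y (snd p) \<omega> > y + real m * b}"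
    have "\<forall>p\<in>I. \<exists>B. \<forall>b\<ge>B. \<forall>\<^sub>F (x, y) in at_top \<times>\<^sub>F at_top.
        prob (?up p b x y) \<le> (1 + e) * ?J p x y"
    proof
      fix p assume p: "p \<in> I"
      note [measurable] = XI[OF p]
      have le: "prob (?up p b x y) \<le> ?J p (x - real n * b) (y - real m * b)
        + \<P>(\<omega> in M. \<omega> \<in> other_large (fst p) (snd p) b
              \<and> X (fst p) \<omega> > x / real n \<and> Y (snd p) \<omega> > y / real m)" for b x y
        unfolding joint_tail_def by (intro measure_Un_le) auto
      obtain B where B: "\<And>b. b \<ge> B \<Longrightarrow> \<forall>\<^sub>F (x, y) in at_top \<times>\<^sub>F at_top.
        ?J p (x - real n * b) (y - real m * b)
        + \<P>(\<omega> in M. \<omega> \<in> other_large (fst p) (snd p) b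
              \<and> X (fst p) \<omega> > x / real n \<and> Y (snd p) \<omega> > y / real m) \<le> (1 + e) * ?J p x y"
        using big_jump_upper[of "fst p" "snd p", OF _ _ e] p unfolding I_def mem_Times_iff by blast
      have "\<forall>\<^sub>F (x, y) in at_top \<times>\<^sub>F at_top. prob (?up p b x y) \<le> (1 + e) * ?J p x y"
        if "b \<ge> B" for b
        using B[OF that] by eventually_elim (use le order_trans in blast)
      then show "\<exists>B. \<forall>b\<ge>B. \<forall>\<^sub>F (x, y) in at_top \<times>\<^sub>F at_top.
        prob (?up p b x y) \<le> (1 + e) * ?J p x y" by blast
    qed
    from bchoice[OF this] obtain Bu where Bu: "\<And>p b. p \<in> I \<Longrightarrow> b \<ge> Bu p \<Longrightarrow>
        \<forall>\<^sub>F (x, y) in at_top \<times>\<^sub>F at_top. prob (?up p b x y) \<le> (1 + e) * ?J p x y"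
      by blast
    have "\<forall>p\<in>I. \<exists>B. \<forall>b\<ge>B. \<forall>\<^sub>F (x, y) in at_top \<times>\<^sub>F at_top.
        (1 - e) * ?J p x y \<le> prob (?lo p b x y)"
      using big_jump_lower[OF _ _ e] by (auto simp: I_def)
    from bchoice[OF this] obtain Bl where Bl: "\<And>p b. p \<in> I \<Longrightarrow> b \<ge> Bl p \<Longrightarrow>
        \<forall>\<^sub>F (x, y) in at_top \<times>\<^sub>F at_top. (1 - e) * ?J p x y \<le> prob (?lo p b x y)"
      by blast
    \<comment> \<open>One level that serves all pairs of indices, in both bounds.\<close>
    define b where "b = Max (insert 0 (Bu ` I \<union> Bl ` I))"
    have b: "b \<ge> 0" "\<And>p. p \<in> I \<Longrightarrow> b \<ge> Bu p" "\<And>p. p \<in> I \<Longrightarrow> b \<ge> Bl p"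
      unfolding b_def using finI by (auto intro!: Max_ge)
    have "\<forall>\<^sub>F xy in at_top \<times>\<^sub>F at_top. \<forall>p\<in>I.
        prob (?up p b (fst xy) (snd xy)) \<le> (1 + e) * ?J p (fst xy) (snd xy)"
      using Bu b finI by (intro eventually_ball_finite) (auto simp: case_prod_beta')
    moreover have "\<forall>\<^sub>F xy in at_top \<times>\<^sub>F at_top. \<forall>p\<in>I.
        (1 - e) * ?J p (fst xy) (snd xy) \<le> prob (?lo p b (fst xy) (snd xy))"
      using Bl b finI by (intro eventually_ball_finite) (auto simp: case_prod_beta')
    moreover have "\<forall>\<^sub>F xy :: real \<times> real in at_top \<times>\<^sub>F at_top. fst xy \<ge> 0 \<and> snd xy \<ge> 0"
      unfolding eventually_at_top_prod by auto
    ultimately show ?thesis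
    proof eventually_elim
      case (elim xy)
      obtain x y where xy: "xy = (x, y)" by (cases xy)
      with elim have up: "\<And>p. p \<in> I \<Longrightarrow> prob (?up p b x y) \<le> (1 + e) * ?J p x y"
        and lo: "\<And>p. p \<in> I \<Longrightarrow> (1 - e) * ?J p x y \<le> prob (?lo p b x y)"
        and nonneg: "x \<ge> 0" "y \<ge> 0" by auto
      have "?up p b x y \<in> events \<and> ?lo p b x y \<in> events" if "p \<in> I" for p
      proof -
        note [measurable] = XI[OF that]
        show ?thesis by measurable
      qed
      then have upsets: "(\<lambda>p. ?up p b x y) ` I \<subseteq> events"
        and losets: "(\<lambda>p. ?lo p b x y) ` I \<subseteq> events" by blast+
      have "joint_tail M U V x y \<le> prob (\<Union>p\<in>I. ?up p b x y)"
        unfolding joint_tail_def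
      proof (intro finite_measure_mono subsetI)
        show "(\<Union>p\<in>I. ?up p b x y) \<in> events"
          using upsets finI by (intro sets.finite_UN) auto
        fix \<omega> assume \<omega>: "\<omega> \<in> {\<omega> \<in> space M. x < U \<omega> \<and> y < V \<omega>}"
        then have "x < (\<Sum>k=1..n. max 0 (X k \<omega>))" "y < (\<Sum>l=1..m. max 0 (Y l \<omega>))"
          using U_le[of \<omega>] V_le[of \<omega>] by auto
        obtain k where k: "k \<in> {1..n}" "X k \<omega> > x / real n"
          "X k \<omega> > x - real n * b \<or> (\<exists>i\<in>{1..n} - {k}. X i \<omega> > b)"
          using sum_pos_parts_gt_cases[OF _ nonneg(1) b(1) \<open>x < (\<Sum>k=1..n. max 0 (X k \<omega>))\<close>]
          by auto
        obtain l where l: "l \<in> {1..m}" "Y l \<omega> > y / real m"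
          "Y l \<omega> > y - real m * b \<or> (\<exists>j\<in>{1..m} - {l}. Y j \<omega> > b)"
          using sum_pos_parts_gt_cases[OF _ nonneg(2) b(1) \<open>y < (\<Sum>l=1..m. max 0 (Y l \<omega>))\<close>]
          by auto
        have "\<omega> \<in> ?up (k, l) b x y"
          using k l \<omega> by (force simp: other_large_def)
        then show "\<omega> \<in> (\<Union>p\<in>I. ?up p b x y)"
          using k(1) l(1) unfolding I_def by blast
      qed
      also have "\<dots> \<le> (\<Sum>p\<in>I. prob (?up p b x y))"
        using upsets finI by (intro finite_measure_subadditive_finite)
      also have "\<dots> \<le> (\<Sum>p\<in>I. (1 + e) * ?J p x y)"
        using up by (rule sum_mono)
      finally have upper: "joint_tail M U V x y \<le> (1 + e) * (\<Sum>p\<in>I. ?J p x y)"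
        by (simp add: sum_distrib_left)
      \<comment> \<open>For \<open>p \<noteq> q\<close> one of the two big variables of \<open>q\<close> is not a big variable of \<open>p\<close>.\<close>
      have disj: "disjoint_family_on (\<lambda>p. ?lo p b x y) I"
        unfolding disjoint_family_on_def
      proof (intro ballI impI equals0I)
        fix p q \<omega> assume p: "p \<in> I" and q: "q \<in> I" and "p \<noteq> q"
          and "\<omega> \<in> ?lo p b x y \<inter> ?lo q b x y"
        then have \<omega>: "\<omega> \<in> space M" "\<omega> \<notin> other_large (fst p) (snd p) b"
          "X (fst q) \<omega> > x + real n * b" "Y (snd q) \<omega> > y + real m * b" by auto
        have "1 * b \<le> real n * b" "1 * b \<le> real m * b"
          using p b by (intro mult_right_mono; auto simp: I_def)+
        then have "X (fst q) \<omega> > b" "Y (snd q) \<omega> > b" using \<omega> nonneg by linarith+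
        with \<omega>(1,2) q \<open>p \<noteq> q\<close> show False
          by (cases p; cases q) (force simp: other_large_def I_def)
      qed
      have "(1 - e) * (\<Sum>p\<in>I. ?J p x y) \<le> (\<Sum>p\<in>I. prob (?lo p b x y))"
        unfolding sum_distrib_left using lo by (rule sum_mono)
      also have "\<dots> = prob (\<Union>p\<in>I. ?lo p b x y)"
        using finite_measure_finite_Union[OF finI losets disj] by simp
      also have "\<dots> \<le> joint_tail M U V x y"
        unfolding joint_tail_def
      proof (intro finite_measure_mono subsetI)
        fix \<omega> assume "\<omega> \<in> (\<Union>p\<in>I. ?lo p b x y)"
        then obtain k l where kl: "k \<in> {1..n}" "l \<in> {1..m}" and \<omega>: "\<omega> \<in> space M"
          and small: "\<omega> \<notin> other_large k l b"
          and big: "X k \<omega> > x + real n * b" "Y l \<omega> > y + real m * b"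
          by (auto simp: I_def)
        have "(\<Sum>i\<in>{1..n} - {k}. \<bar>X i \<omega>\<bar>) \<le> real (card ({1..n} - {k})) * b"
          using small \<omega> by (intro sum_bounded_above) (auto simp: other_large_def not_less)
        also have "\<dots> \<le> real n * b"
          using b card_Diff1_le[of "{1..n}" k] by (intro mult_right_mono) auto
        finally have "U \<omega> > x" using U_ge[OF \<omega> kl(1)] big by linarith
        have "(\<Sum>j\<in>{1..m} - {l}. \<bar>Y j \<omega>\<bar>) \<le> real (card ({1..m} - {l})) * b"
          using small \<omega> by (intro sum_bounded_above) (auto simp: other_large_def not_less)
        also have "\<dots> \<le> real m * b"
          using b card_Diff1_le[of "{1..m}" l] by (intro mult_right_mono) auto
        finally have "V \<omega> > y" using V_ge[OF \<omega> kl(2)] big by linarith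
        with \<omega> \<open>U \<omega> > x\<close> show "\<omega> \<in> {\<omega> \<in> space M. x < U \<omega> \<and> y < V \<omega>}" by simp
      qed auto
      finally have "(1 - e) * (\<Sum>p\<in>I. ?J p x y) \<le> joint_tail M U V x y" .
      with upper show ?case by (simp add: xy algebra_simps abs_le_iff)
    qed
  qed
  then show ?thesis
    unfolding sum_eq
    by (subst asymp_equiv_iff_relative_error)
      (auto simp: case_prod_beta' intro!: sum_nonneg joint_tail_nonneg)
qed

end

section \<open>An independent random factor\<close>

text \<open>
  The complement of the support is a union of null open sets. By second countability countably many
  basic open sets suffice, so it is null; this turns a bounded support into an almost sure bound.
\<close>

lemma AE_in_measure_support:
  fixes \<mu> :: "'a::second_countable_topology measure"
  assumes sets: "sets \<mu> = sets borel"
  shows "AE x in \<mu>. x \<in> measure_support \<mu>"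
proof -
  obtain \<B> :: "'a set set" where \<B>: "countable \<B>" "topological_basis \<B>"
    using ex_countable_basis by blast
  define \<N> where "\<N> = {U \<in> \<B>. emeasure \<mu> U = 0}"
  have "(\<Union>U\<in>\<N>. U) \<in> null_sets \<mu>"
  proof (rule null_sets_UN')
    show "countable \<N>" using \<B>(1) by (simp add: \<N>_def)
    fix U assume U: "U \<in> \<N>"
    then have "open U" using \<B>(2) by (auto simp: \<N>_def topological_basis_open)
    with U sets show "U \<in> null_sets \<mu>" by (auto simp: \<N>_def null_sets_def)
  qed
  moreover have "{x \<in> space \<mu>. x \<notin> measure_support \<mu>} \<subseteq> (\<Union>U\<in>\<N>. U)"
  proof
    fix x assume "x \<in> {x \<in> space \<mu>. x \<notin> measure_support \<mu>}"
    then obtain U where U: "open U" "x \<in> U" "emeasure \<mu> U = 0"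
      by (auto simp: measure_support_def)
    with \<B>(2) obtain W where W: "W \<in> \<B>" "x \<in> W" "W \<subseteq> U"
      using topological_basisE by metis
    have "emeasure \<mu> W \<le> emeasure \<mu> U"
      using W U sets by (intro emeasure_mono) auto
    with U W show "x \<in> (\<Union>U\<in>\<N>. U)" by (auto simp: \<N>_def)
  qed
  ultimately show ?thesis by (rule AE_I')
qed

lemma (in prob_space) indep_elements_distr_pair:
  assumes indep: "indep_elements M N1 Z1 N2 Z2"
    and [measurable]: "Z1 \<in> measurable M N1" "Z2 \<in> measurable M N2"
  shows "distr M (N1 \<Otimes>\<^sub>M N2) (\<lambda>\<omega>. (Z1 \<omega>, Z2 \<omega>)) = distr M N1 Z1 \<Otimes>\<^sub>M distr M N2 Z2"
proof (rule pair_measure_eqI[symmetric])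
  show "sigma_finite_measure (distr M N1 Z1)" "sigma_finite_measure (distr M N2 Z2)"
    by (auto intro!: prob_space_imp_sigma_finite prob_space_distr)
  show "sets (distr M N1 Z1 \<Otimes>\<^sub>M distr M N2 Z2)
      = sets (distr M (N1 \<Otimes>\<^sub>M N2) (\<lambda>\<omega>. (Z1 \<omega>, Z2 \<omega>)))"
    by (simp cong: sets_pair_measure_cong)
  fix A B assume "A \<in> sets (distr M N1 Z1)" "B \<in> sets (distr M N2 Z2)"
  then have AB [measurable]: "A \<in> sets N1" "B \<in> sets N2" by auto
  have "prob ((Z1 -` A \<inter> space M) \<inter> (Z2 -` B \<inter> space M))
      = prob (Z1 -` A \<inter> space M) * prob (Z2 -` B \<inter> space M)"
    using indep AB unfolding indep_elements_def by (intro indep_setD) auto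
  moreover have "(\<lambda>\<omega>. (Z1 \<omega>, Z2 \<omega>)) -` (A \<times> B) \<inter> space M
      = (Z1 -` A \<inter> space M) \<inter> (Z2 -` B \<inter> space M)" by auto
  ultimately show "emeasure (distr M N1 Z1) A * emeasure (distr M N2 Z2) B
      = emeasure (distr M (N1 \<Otimes>\<^sub>M N2) (\<lambda>\<omega>. (Z1 \<omega>, Z2 \<omega>))) (A \<times> B)"
    by (simp add: emeasure_distr emeasure_eq_measure ennreal_mult)
qed

text \<open>
  Independence allows the first component to be frozen: a probability involving both is the average,
  over the law of the first, of the probability with the first held constant.
\<close>

lemma (in prob_space) indep_elements_disintegration:
  assumes indep: "indep_elements M N1 Z1 N2 Z2"
    and Z1 [measurable]: "Z1 \<in> measurable M N1" and Z2 [measurable]: "Z2 \<in> measurable M N2"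
    and A [measurable]: "A \<in> sets (N1 \<Otimes>\<^sub>M N2)"
  shows "integrable (distr M N1 Z1) (\<lambda>\<theta>. \<P>(\<omega> in M. (\<theta>, Z2 \<omega>) \<in> A))"
    and "\<P>(\<omega> in M. (Z1 \<omega>, Z2 \<omega>) \<in> A)
       = (\<integral>\<theta>. \<P>(\<omega> in M. (\<theta>, Z2 \<omega>) \<in> A) \<partial>distr M N1 Z1)"
proof -
  let ?\<mu> = "distr M N1 Z1" and ?\<nu> = "distr M N2 Z2"
  interpret \<mu>: prob_space ?\<mu> by (intro prob_space_distr) simp
  interpret \<nu>: prob_space ?\<nu> by (intro prob_space_distr) simp
  interpret P: pair_prob_space ?\<mu> ?\<nu> ..
  have A': "A \<in> sets (?\<mu> \<Otimes>\<^sub>M ?\<nu>)" using A by (simp cong: sets_pair_measure_cong)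
  then have int: "integrable (?\<mu> \<Otimes>\<^sub>M ?\<nu>) (indicator A :: _ \<Rightarrow> real)"
    by (intro integrable_real_indicator) (simp_all add: P.emeasure_eq_measure)
  have inner: "(\<integral>z. indicator A (\<theta>, z) \<partial>?\<nu>) = \<P>(\<omega> in M. (\<theta>, Z2 \<omega>) \<in> A)" for \<theta>
  proof -
    have [measurable]: "Pair \<theta> -` A \<in> sets N2" using A by (rule sets_Pair1)
    have "(\<integral>z. indicator A (\<theta>, z) \<partial>?\<nu>) = (\<integral>z. indicator (Pair \<theta> -` A) z \<partial>?\<nu>)"
      by (intro Bochner_Integration.integral_cong) (auto simp: indicator_def)
    also have "\<dots> = measure ?\<nu> (Pair \<theta> -` A)"
      using sets.sets_into_space[of "Pair \<theta> -` A" N2] by (simp add: Int_absorb2)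
    also have "\<dots> = \<P>(\<omega> in M. (\<theta>, Z2 \<omega>) \<in> A)"
      by (subst measure_distr) (auto intro!: arg_cong[where f = prob])
    finally show ?thesis .
  qed
  show "integrable ?\<mu> (\<lambda>\<theta>. \<P>(\<omega> in M. (\<theta>, Z2 \<omega>) \<in> A))"
    using P.integrable_fst'[OF int] by (simp add: inner)
  have "\<P>(\<omega> in M. (Z1 \<omega>, Z2 \<omega>) \<in> A) = measure (?\<mu> \<Otimes>\<^sub>M ?\<nu>) A"
    unfolding indep_elements_distr_pair[OF indep Z1 Z2, symmetric]
    by (subst measure_distr) (auto intro!: arg_cong[where f = prob])
  also have "\<dots> = (\<integral>z. indicator A z \<partial>(?\<mu> \<Otimes>\<^sub>M ?\<nu>))"
    using sets.sets_into_space[OF A'] by (simp add: Int_absorb2)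
  also have "\<dots> = (\<integral>\<theta>. \<P>(\<omega> in M. (\<theta>, Z2 \<omega>) \<in> A) \<partial>?\<mu>)"
    using P.integral_fst'[OF int] by (simp add: inner)
  finally show "\<P>(\<omega> in M. (Z1 \<omega>, Z2 \<omega>) \<in> A)
       = (\<integral>\<theta>. \<P>(\<omega> in M. (\<theta>, Z2 \<omega>) \<in> A) \<partial>?\<mu>)" .
qed

lemma (in prob_space) joint_tail_scale_mixture:
  assumes indep: "indep_elements M borel \<Theta> N Z"
    and \<Theta> [measurable]: "\<Theta> \<in> borel_measurable M" and Z [measurable]: "Z \<in> measurable M N"
    and u [measurable]: "u \<in> borel_measurable N" and v [measurable]: "v \<in> borel_measurable N"
  shows "integrable (distr M borel \<Theta>)
           (\<lambda>\<theta>. joint_tail M (\<lambda>\<omega>. \<theta> * u (Z \<omega>)) (\<lambda>\<omega>. \<theta> * v (Z \<omega>)) x y)"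
    and "joint_tail M (\<lambda>\<omega>. \<Theta> \<omega> * u (Z \<omega>)) (\<lambda>\<omega>. \<Theta> \<omega> * v (Z \<omega>)) x y
       = (\<integral>\<theta>. joint_tail M (\<lambda>\<omega>. \<theta> * u (Z \<omega>)) (\<lambda>\<omega>. \<theta> * v (Z \<omega>)) x y \<partial>distr M borel \<Theta>)"
proof -
  define A where "A = {p \<in> space (borel \<Otimes>\<^sub>M N). fst p * u (snd p) > x \<and> fst p * v (snd p) > y}"
  have A: "A \<in> sets (borel \<Otimes>\<^sub>M N)" unfolding A_def by measurable
  have fixed: "\<P>(\<omega> in M. (\<theta>, Z \<omega>) \<in> A)
      = joint_tail M (\<lambda>\<omega>. \<theta> * u (Z \<omega>)) (\<lambda>\<omega>. \<theta> * v (Z \<omega>)) x y" for \<theta>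
    using measurable_space[OF Z]
    by (auto simp: joint_tail_def A_def space_pair_measure intro!: arg_cong[where f = prob])
  have mixed: "\<P>(\<omega> in M. (\<Theta> \<omega>, Z \<omega>) \<in> A)
      = joint_tail M (\<lambda>\<omega>. \<Theta> \<omega> * u (Z \<omega>)) (\<lambda>\<omega>. \<Theta> \<omega> * v (Z \<omega>)) x y"
    using measurable_space[OF Z]
    by (auto simp: joint_tail_def A_def space_pair_measure intro!: arg_cong[where f = prob])
  show "integrable (distr M borel \<Theta>)
           (\<lambda>\<theta>. joint_tail M (\<lambda>\<omega>. \<theta> * u (Z \<omega>)) (\<lambda>\<omega>. \<theta> * v (Z \<omega>)) x y)"
    "joint_tail M (\<lambda>\<omega>. \<Theta> \<omega> * u (Z \<omega>)) (\<lambda>\<omega>. \<Theta> \<omega> * v (Z \<omega>)) x y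
       = (\<integral>\<theta>. joint_tail M (\<lambda>\<omega>. \<theta> * u (Z \<omega>)) (\<lambda>\<omega>. \<theta> * v (Z \<omega>)) x y \<partial>distr M borel \<Theta>)"
    using indep_elements_disintegration[OF indep \<Theta> Z A] by (simp_all add: fixed mixed)
qed

lemma joint_tail_scale_pos:
  assumes "\<theta> > 0"
  shows "joint_tail M (\<lambda>\<omega>. \<theta> * U \<omega>) (\<lambda>\<omega>. \<theta> * V \<omega>) x y = joint_tail M U V (x / \<theta>) (y / \<theta>)"
  using assms by (simp add: joint_tail_def pos_divide_less_eq mult.commute)

text \<open>
  Given \<open>\<Theta> = \<theta>\<close>, the levels become \<open>x / \<theta>\<close> and \<open>y / \<theta>\<close>, which are at least
  \<open>x / c\<close> and \<open>y / c\<close>. Hence the relative error of the equivalence without \<open>\<Theta>\<close> is small uniformly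
  in \<open>\<theta>\<close>, and it survives integration over \<open>\<theta>\<close>. On \<open>\<theta> = 0\<close> both sides vanish for
  nonnegative levels.
\<close>

lemma (in prob_space) asymp_equiv_joint_tail_scale_mixture:
  assumes indep: "indep_elements M borel \<Theta> N Z"
    and \<Theta>: "\<Theta> \<in> borel_measurable M" and Z: "Z \<in> measurable M N"
    and bounded: "AE \<omega> in M. 0 \<le> \<Theta> \<omega> \<and> \<Theta> \<omega> \<le> c"
    and u: "u \<in> borel_measurable N" and v: "v \<in> borel_measurable N"
    and p: "\<And>i. i \<in> I \<Longrightarrow> p i \<in> borel_measurable N"
    and q: "\<And>i. i \<in> I \<Longrightarrow> q i \<in> borel_measurable N"
    and equiv: "(\<lambda>(x, y). joint_tail M (\<lambda>\<omega>. u (Z \<omega>)) (\<lambda>\<omega>. v (Z \<omega>)) x y) \<sim>[at_top \<times>\<^sub>F at_top]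
      (\<lambda>(x, y). \<Sum>i\<in>I. joint_tail M (\<lambda>\<omega>. p i (Z \<omega>)) (\<lambda>\<omega>. q i (Z \<omega>)) x y)"
  shows "(\<lambda>(x, y). joint_tail M (\<lambda>\<omega>. \<Theta> \<omega> * u (Z \<omega>)) (\<lambda>\<omega>. \<Theta> \<omega> * v (Z \<omega>)) x y)
      \<sim>[at_top \<times>\<^sub>F at_top]
      (\<lambda>(x, y). \<Sum>i\<in>I. joint_tail M (\<lambda>\<omega>. \<Theta> \<omega> * p i (Z \<omega>)) (\<lambda>\<omega>. \<Theta> \<omega> * q i (Z \<omega>)) x y)"
proof -
  let ?\<mu> = "distr M borel \<Theta>"
  let ?f = "\<lambda>\<theta>. joint_tail M (\<lambda>\<omega>. \<theta> * u (Z \<omega>)) (\<lambda>\<omega>. \<theta> * v (Z \<omega>))"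
  let ?g = "\<lambda>\<theta> i. joint_tail M (\<lambda>\<omega>. \<theta> * p i (Z \<omega>)) (\<lambda>\<omega>. \<theta> * q i (Z \<omega>))"
  \<comment> \<open>The bound must be positive in order to divide by it; \<open>c\<close> itself may be \<open>0\<close>.\<close>
  define c' where "c' = max 1 c"
  have c': "c' > 0" by (simp add: c'_def)
  have bounded': "AE \<theta> in ?\<mu>. 0 \<le> \<theta> \<and> \<theta> \<le> c'"
    using bounded \<Theta> by (subst AE_distr_iff) (auto simp: c'_def)
  have f: "integrable ?\<mu> (\<lambda>\<theta>. ?f \<theta> x y)"
    "joint_tail M (\<lambda>\<omega>. \<Theta> \<omega> * u (Z \<omega>)) (\<lambda>\<omega>. \<Theta> \<omega> * v (Z \<omega>)) x y = (\<integral>\<theta>. ?f \<theta> x y \<partial>?\<mu>)" for x y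
    using joint_tail_scale_mixture[OF indep \<Theta> Z u v] by blast+
  have g: "integrable ?\<mu> (\<lambda>\<theta>. ?g \<theta> i x y)"
    "joint_tail M (\<lambda>\<omega>. \<Theta> \<omega> * p i (Z \<omega>)) (\<lambda>\<omega>. \<Theta> \<omega> * q i (Z \<omega>)) x y = (\<integral>\<theta>. ?g \<theta> i x y \<partial>?\<mu>)"
    if "i \<in> I" for i x y
    using joint_tail_scale_mixture[OF indep \<Theta> Z p[OF that] q[OF that]] by blast+
  have "\<forall>\<^sub>F (x, y) in at_top \<times>\<^sub>F at_top.
      \<bar>(\<integral>\<theta>. ?f \<theta> x y \<partial>?\<mu>) - (\<Sum>i\<in>I. \<integral>\<theta>. ?g \<theta> i x y \<partial>?\<mu>)\<bar>
        \<le> e * (\<Sum>i\<in>I. \<integral>\<theta>. ?g \<theta> i x y \<partial>?\<mu>)" if e: "e > 0" for e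
  proof -
    have "\<forall>\<^sub>F (x, y) in at_top \<times>\<^sub>F at_top. \<bar>?f 1 x y - (\<Sum>i\<in>I. ?g 1 i x y)\<bar> \<le> e * (\<Sum>i\<in>I. ?g 1 i x y)"
      using equiv e
      by (subst (asm) asymp_equiv_iff_relative_error)
        (auto simp: case_prod_beta' intro!: sum_nonneg joint_tail_nonneg)
    then obtain R where R: "\<And>x y. x \<ge> R \<Longrightarrow> y \<ge> R \<Longrightarrow>
        \<bar>?f 1 x y - (\<Sum>i\<in>I. ?g 1 i x y)\<bar> \<le> e * (\<Sum>i\<in>I. ?g 1 i x y)"
      by (auto simp: eventually_at_top_prod)
    have "\<bar>(\<integral>\<theta>. ?f \<theta> x y \<partial>?\<mu>) - (\<Sum>i\<in>I. \<integral>\<theta>. ?g \<theta> i x y \<partial>?\<mu>)\<bar>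
        \<le> e * (\<Sum>i\<in>I. \<integral>\<theta>. ?g \<theta> i x y \<partial>?\<mu>)"
      if x: "x \<ge> max 0 (R * c')" and y: "y \<ge> max 0 (R * c')" for x y
    proof -
      have pointwise: "\<bar>?f \<theta> x y - (\<Sum>i\<in>I. ?g \<theta> i x y)\<bar> \<le> e * (\<Sum>i\<in>I. ?g \<theta> i x y)"
        if \<theta>: "0 \<le> \<theta> \<and> \<theta> \<le> c'" for \<theta>
      proof (cases "\<theta> = 0")
        case True
        with x y show ?thesis by (simp add: joint_tail_def)
      next
        case False
        with \<theta> have pos: "\<theta> > 0" by simp
        have "R \<le> x / c'" "R \<le> y / c'" using x y c' by (simp_all add: pos_le_divide_eq)
        moreover have "x / c' \<le> x / \<theta>" "y / c' \<le> y / \<theta>"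
          using x y \<theta> pos by (auto intro!: divide_left_mono)
        ultimately have "R \<le> x / \<theta>" "R \<le> y / \<theta>" by linarith+
        then show ?thesis using R[of "x / \<theta>" "y / \<theta>"] by (simp add: joint_tail_scale_pos[OF pos])
      qed
      have intG: "integrable ?\<mu> (\<lambda>\<theta>. \<Sum>i\<in>I. ?g \<theta> i x y)"
        using g by (intro Bochner_Integration.integrable_sum) auto
      have G: "(\<Sum>i\<in>I. \<integral>\<theta>. ?g \<theta> i x y \<partial>?\<mu>) = (\<integral>\<theta>. (\<Sum>i\<in>I. ?g \<theta> i x y) \<partial>?\<mu>)"
        using g by (intro Bochner_Integration.integral_sum[symmetric]) auto
      have "\<bar>(\<integral>\<theta>. ?f \<theta> x y \<partial>?\<mu>) - (\<integral>\<theta>. (\<Sum>i\<in>I. ?g \<theta> i x y) \<partial>?\<mu>)\<bar>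
          = \<bar>\<integral>\<theta>. ?f \<theta> x y - (\<Sum>i\<in>I. ?g \<theta> i x y) \<partial>?\<mu>\<bar>"
        using f intG by simp
      also have "\<dots> \<le> (\<integral>\<theta>. \<bar>?f \<theta> x y - (\<Sum>i\<in>I. ?g \<theta> i x y)\<bar> \<partial>?\<mu>)"
        by (rule integral_abs_bound)
      also have "\<dots> \<le> (\<integral>\<theta>. e * (\<Sum>i\<in>I. ?g \<theta> i x y) \<partial>?\<mu>)"
        using bounded' pointwise f intG by (intro integral_mono_AE) auto
      finally show ?thesis by (simp add: G)
    qed
    then show ?thesis by (auto simp: eventually_at_top_prod intro!: exI[of _ "max 0 (R * c')"])
  qed
  then show ?thesis
    by (subst asymp_equiv_iff_relative_error)
      (auto simp: case_prod_beta' f g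
        intro!: sum_nonneg Bochner_Integration.integral_nonneg joint_tail_nonneg)
qed

section \<open>Functionals dominated by one coordinate\<close>

text \<open>
  The two inequalities are exactly what \<open>joint_tail_squeezed\<close> asks for: such a functional cannot be
  large without a large coordinate, and it is large as soon as one coordinate dominates all others.
  Sums, maxima of partial sums and maxima share this property, so that the three relations of the
  theorem are instances of one.
\<close>

definition one_jump_functional :: "nat \<Rightarrow> ((nat \<Rightarrow> real) \<Rightarrow> real) \<Rightarrow> bool" where
  "one_jump_functional n h \<longleftrightarrow> h \<in> borel_measurable (\<Pi>\<^sub>M k\<in>{1..n}. borel) \<and>
     (\<forall>z. h z \<le> (\<Sum>k=1..n. max 0 (z k)) \<and>
          (\<forall>k\<in>{1..n}. z k - (\<Sum>i\<in>{1..n} - {k}. \<bar>z i\<bar>) \<le> h z))"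

lemma one_jump_functionalI:
  assumes "h \<in> borel_measurable (\<Pi>\<^sub>M k\<in>{1..n}. borel)"
    and "\<And>z. h z \<le> (\<Sum>k=1..n. max 0 (z k))"
    and "\<And>z k. k \<in> {1..n} \<Longrightarrow> z k - (\<Sum>i\<in>{1..n} - {k}. \<bar>z i\<bar>) \<le> h z"
  shows "one_jump_functional n h"
  using assms by (simp add: one_jump_functional_def)

lemma one_jump_functional_sum: "one_jump_functional n (\<lambda>z. \<Sum>k=1..n. z k)"
proof (rule one_jump_functionalI)
  fix z :: "nat \<Rightarrow> real" and k assume k: "k \<in> {1..n}"
  have "(\<Sum>k=1..n. z k) = z k + (\<Sum>i\<in>{1..n} - {k}. z i)"
    using k by (simp add: sum.remove)
  moreover have "(\<Sum>i\<in>{1..n} - {k}. - \<bar>z i\<bar>) \<le> (\<Sum>i\<in>{1..n} - {k}. z i)"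
    by (rule sum_mono) simp
  ultimately show "z k - (\<Sum>i\<in>{1..n} - {k}. \<bar>z i\<bar>) \<le> (\<Sum>k=1..n. z k)"
    by (simp add: sum_negf)
qed (auto intro!: sum_mono borel_measurable_sum measurable_component_singleton)

lemma one_jump_functional_Max_sums:
  assumes "n \<ge> 1"
  shows "one_jump_functional n (\<lambda>z. MAX i\<in>{1..n}. \<Sum>k=1..i. z k)"
proof (rule one_jump_functionalI)
  show "(\<lambda>z :: nat \<Rightarrow> real. MAX i\<in>{1..n}. \<Sum>k=1..i. z k) \<in> borel_measurable (\<Pi>\<^sub>M k\<in>{1..n}. borel)"
    by (rule borel_measurable_Max[of "{1..n}" "\<lambda>i (z :: nat \<Rightarrow> real). \<Sum>k=1..i. z k"])
      (auto intro!: borel_measurable_sum measurable_component_singleton)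
next
  fix z :: "nat \<Rightarrow> real"
  have "(\<Sum>k=1..i. z k) \<le> (\<Sum>k=1..n. max 0 (z k))" if "i \<in> {1..n}" for i
  proof -
    have "(\<Sum>k=1..i. z k) \<le> (\<Sum>k=1..i. max 0 (z k))" by (rule sum_mono) simp
    also have "\<dots> \<le> (\<Sum>k=1..n. max 0 (z k))" using that by (intro sum_mono2) auto
    finally show ?thesis .
  qed
  then show "(MAX i\<in>{1..n}. \<Sum>k=1..i. z k) \<le> (\<Sum>k=1..n. max 0 (z k))"
    using assms by (intro Max.boundedI) auto
next
  fix z :: "nat \<Rightarrow> real" and k assume "k \<in> {1..n}"
  then have "z k - (\<Sum>i\<in>{1..n} - {k}. \<bar>z i\<bar>) \<le> (\<Sum>k=1..n. z k)"
    using one_jump_functional_sum by (simp add: one_jump_functional_def)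
  also have "\<dots> \<le> (MAX i\<in>{1..n}. \<Sum>k=1..i. z k)"
    using assms by (intro Max_ge) auto
  finally show "z k - (\<Sum>i\<in>{1..n} - {k}. \<bar>z i\<bar>) \<le> (MAX i\<in>{1..n}. \<Sum>k=1..i. z k)" .
qed

lemma one_jump_functional_Max:
  assumes "n \<ge> 1"
  shows "one_jump_functional n (\<lambda>z. MAX k\<in>{1..n}. z k)"
proof (rule one_jump_functionalI)
  show "(\<lambda>z :: nat \<Rightarrow> real. MAX k\<in>{1..n}. z k) \<in> borel_measurable (\<Pi>\<^sub>M k\<in>{1..n}. borel)"
    by (rule borel_measurable_Max[of "{1..n}" "\<lambda>i (z :: nat \<Rightarrow> real). z i"])
      (auto intro!: measurable_component_singleton)
next
  fix z :: "nat \<Rightarrow> real"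
  have "z k \<le> (\<Sum>k=1..n. max 0 (z k))" if "k \<in> {1..n}" for k
    using member_le_sum[of k "{1..n}" "\<lambda>k. max 0 (z k)"] that by simp
  then show "(MAX k\<in>{1..n}. z k) \<le> (\<Sum>k=1..n. max 0 (z k))"
    using assms by (intro Max.boundedI) auto
next
  fix z :: "nat \<Rightarrow> real" and k assume "k \<in> {1..n}"
  then have "z k \<le> (MAX k\<in>{1..n}. z k)" by (intro Max_ge) auto
  moreover have "(\<Sum>i\<in>{1..n} - {k}. \<bar>z i\<bar>) \<ge> 0" by (intro sum_nonneg) simp
  ultimately show "z k - (\<Sum>i\<in>{1..n} - {k}. \<bar>z i\<bar>) \<le> (MAX k\<in>{1..n}. z k)" by linarith
qed

text \<open>
  The functionals are evaluated at the restrictions of the two families to their index sets, since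
  the joint law that is independent of \<open>\<Theta>\<close> lives on finite products.
\<close>

lemma (in gtai_vectors) joint_tail_one_jump_functional:
  assumes indep: "indep_elements M borel \<Theta>
      ((\<Pi>\<^sub>M k\<in>{1..n}. borel) \<Otimes>\<^sub>M (\<Pi>\<^sub>M l\<in>{1..m}. borel))
      (\<lambda>\<omega>. (\<lambda>k\<in>{1..n}. X k \<omega>, \<lambda>l\<in>{1..m}. Y l \<omega>))"
    and \<Theta>: "\<Theta> \<in> borel_measurable M" and bounded: "AE \<omega> in M. 0 \<le> \<Theta> \<omega> \<and> \<Theta> \<omega> \<le> c"
    and h: "one_jump_functional n h" and h': "one_jump_functional m h'"
  shows "(\<lambda>(x, y). joint_tail M (\<lambda>\<omega>. \<Theta> \<omega> * h (\<lambda>k\<in>{1..n}. X k \<omega>))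
             (\<lambda>\<omega>. \<Theta> \<omega> * h' (\<lambda>l\<in>{1..m}. Y l \<omega>)) x y) \<sim>[at_top \<times>\<^sub>F at_top]
         (\<lambda>(x, y). \<Sum>k=1..n. \<Sum>l=1..m. joint_tail M (\<lambda>\<omega>. \<Theta> \<omega> * X k \<omega>) (\<lambda>\<omega>. \<Theta> \<omega> * Y l \<omega>) x y)"
proof -
  let ?NX = "\<Pi>\<^sub>M k\<in>{1..n}. (borel :: real measure)"
  let ?NY = "\<Pi>\<^sub>M l\<in>{1..m}. (borel :: real measure)"
  let ?ZX = "\<lambda>\<omega>. \<lambda>k\<in>{1..n}. X k \<omega>" and ?ZY = "\<lambda>\<omega>. \<lambda>l\<in>{1..m}. Y l \<omega>"
  define I where "I = {1..n} \<times> {1..m}"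
  have hm [measurable]: "h \<in> borel_measurable ?NX" "h' \<in> borel_measurable ?NY"
    using h h' by (auto simp: one_jump_functional_def)
  have ZX [measurable]: "?ZX \<in> measurable M ?NX" and ZY [measurable]: "?ZY \<in> measurable M ?NY"
    by (auto intro!: measurable_restrict)
  have "(\<lambda>(x, y). joint_tail M (\<lambda>\<omega>. h (?ZX \<omega>)) (\<lambda>\<omega>. h' (?ZY \<omega>)) x y) \<sim>[at_top \<times>\<^sub>F at_top]
         (\<lambda>(x, y). \<Sum>k=1..n. \<Sum>l=1..m. joint_tail M (X k) (Y l) x y)"
  proof (rule joint_tail_squeezed)
    fix \<omega>
    have "h (?ZX \<omega>) \<le> (\<Sum>k=1..n. max 0 (?ZX \<omega> k))"
      using h unfolding one_jump_functional_def by blast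
    then show "h (?ZX \<omega>) \<le> (\<Sum>k=1..n. max 0 (X k \<omega>))" by simp
    have "h' (?ZY \<omega>) \<le> (\<Sum>l=1..m. max 0 (?ZY \<omega> l))"
      using h' unfolding one_jump_functional_def by blast
    then show "h' (?ZY \<omega>) \<le> (\<Sum>l=1..m. max 0 (Y l \<omega>))" by simp
  next
    fix \<omega> k assume k: "k \<in> {1..n}"
    then have "?ZX \<omega> k - (\<Sum>i\<in>{1..n} - {k}. \<bar>?ZX \<omega> i\<bar>) \<le> h (?ZX \<omega>)"
      using h unfolding one_jump_functional_def by blast
    then show "X k \<omega> - (\<Sum>i\<in>{1..n} - {k}. \<bar>X i \<omega>\<bar>) \<le> h (?ZX \<omega>)"
      using k by simp
  next
    fix \<omega> l assume l: "l \<in> {1..m}"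
    then have "?ZY \<omega> l - (\<Sum>j\<in>{1..m} - {l}. \<bar>?ZY \<omega> j\<bar>) \<le> h' (?ZY \<omega>)"
      using h' unfolding one_jump_functional_def by blast
    then show "Y l \<omega> - (\<Sum>j\<in>{1..m} - {l}. \<bar>Y j \<omega>\<bar>) \<le> h' (?ZY \<omega>)"
      using l by simp
  qed measurable
  moreover have "(\<Sum>k=1..n. \<Sum>l=1..m. joint_tail M (X k) (Y l) x y)
      = (\<Sum>p\<in>I. joint_tail M (\<lambda>\<omega>. ?ZX \<omega> (fst p)) (\<lambda>\<omega>. ?ZY \<omega> (snd p)) x y)" for x y
    unfolding I_def sum.cartesian_product by (intro sum.cong) auto
  ultimately have equiv: "(\<lambda>(x, y). joint_tail M (\<lambda>\<omega>. h (?ZX \<omega>)) (\<lambda>\<omega>. h' (?ZY \<omega>)) x y)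
      \<sim>[at_top \<times>\<^sub>F at_top]
      (\<lambda>(x, y). \<Sum>p\<in>I. joint_tail M (\<lambda>\<omega>. ?ZX \<omega> (fst p)) (\<lambda>\<omega>. ?ZY \<omega> (snd p)) x y)"
    by simp
  have pairs: "(\<lambda>\<omega>. (?ZX \<omega>, ?ZY \<omega>)) \<in> measurable M (?NX \<Otimes>\<^sub>M ?NY)"
    "(\<lambda>z. h (fst z)) \<in> borel_measurable (?NX \<Otimes>\<^sub>M ?NY)"
    "(\<lambda>z. h' (snd z)) \<in> borel_measurable (?NX \<Otimes>\<^sub>M ?NY)"
    by measurable
  have projX: "(\<lambda>z. fst z (fst p)) \<in> borel_measurable (?NX \<Otimes>\<^sub>M ?NY)" if "p \<in> I" for p
    by (rule measurable_compose[OF measurable_fst measurable_component_singleton])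
      (use that in \<open>auto simp: I_def\<close>)
  have projY: "(\<lambda>z. snd z (snd p)) \<in> borel_measurable (?NX \<Otimes>\<^sub>M ?NY)" if "p \<in> I" for p
    by (rule measurable_compose[OF measurable_snd measurable_component_singleton])
      (use that in \<open>auto simp: I_def\<close>)
  have "(\<lambda>(x, y). joint_tail M (\<lambda>\<omega>. \<Theta> \<omega> * h (?ZX \<omega>)) (\<lambda>\<omega>. \<Theta> \<omega> * h' (?ZY \<omega>)) x y)
      \<sim>[at_top \<times>\<^sub>F at_top] (\<lambda>(x, y). \<Sum>p\<in>I.
        joint_tail M (\<lambda>\<omega>. \<Theta> \<omega> * ?ZX \<omega> (fst p)) (\<lambda>\<omega>. \<Theta> \<omega> * ?ZY \<omega> (snd p)) x y)"
    using asymp_equiv_joint_tail_scale_mixture[OF indep \<Theta> _ bounded,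
        of "\<lambda>z. h (fst z)" "\<lambda>z. h' (snd z)" I "\<lambda>p z. fst z (fst p)" "\<lambda>p z. snd z (snd p)"]
      pairs equiv projX projY unfolding fst_conv snd_conv by blast
  moreover have "(\<Sum>p\<in>I.
        joint_tail M (\<lambda>\<omega>. \<Theta> \<omega> * ?ZX \<omega> (fst p)) (\<lambda>\<omega>. \<Theta> \<omega> * ?ZY \<omega> (snd p)) x y)
      = (\<Sum>k=1..n. \<Sum>l=1..m. joint_tail M (\<lambda>\<omega>. \<Theta> \<omega> * X k \<omega>) (\<lambda>\<omega>. \<Theta> \<omega> * Y l \<omega>) x y)" for x y
    unfolding I_def sum.cartesian_product by (intro sum.cong) auto
  ultimately show ?thesis by simp
qed

lemma Max_mult_left:
  fixes f :: "'i \<Rightarrow> real"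
  assumes "finite A" "A \<noteq> {}" "c \<ge> 0"
  shows "(MAX i\<in>A. c * f i) = c * (MAX i\<in>A. f i)"
  using mono_Max_commute[of "\<lambda>x. c * x" "f ` A"] assms
  by (simp add: monoI mult_left_mono image_image)

section \<open>Randomly weighted sums and maxima\<close>

theorem corollary6p1:
  fixes M :: "'a measure"
    and X Y :: "nat \<Rightarrow> 'a \<Rightarrow> real"
    and F G :: "nat \<Rightarrow> real measure"
    and \<Theta> :: "'a \<Rightarrow> real"
    and n :: nat
  assumes "prob_space M"
    and "n \<ge> 1"
    and "\<And>k. k \<in> {1..n} \<Longrightarrow> X k \<in> borel_measurable M"
    and "\<And>l. l \<in> {1..n} \<Longrightarrow> Y l \<in> borel_measurable M"
    and "\<Theta> \<in> borel_measurable M"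
    and "\<And>k. k \<in> {1..n} \<Longrightarrow> distr M borel (X k) = F k"
    and "\<And>l. l \<in> {1..n} \<Longrightarrow> distr M borel (Y l) = G l"
    and "\<And>k x. k \<in> {1..n} \<Longrightarrow> x \<ge> 0 \<Longrightarrow> tail (F k) x > 0"
    and "\<And>l y. l \<in> {1..n} \<Longrightarrow> y \<ge> 0 \<Longrightarrow> tail (G l) y > 0"
    and "\<And>k. k \<in> {1..n} \<Longrightarrow> dominatedly_varying (F k) \<and> long_tailed (F k)"
    and "\<And>l. l \<in> {1..n} \<Longrightarrow> dominatedly_varying (G l) \<and> long_tailed (G l)"
    and "\<And>k l x y. k \<in> {1..n} \<Longrightarrow> l \<in> {1..n} \<Longrightarrow> x \<ge> 0 \<Longrightarrow> y \<ge> 0 \<Longrightarrow>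
           joint_tail M (X k) (Y l) x y > 0"
    and "GTAI M n n X Y"
    and "AE \<omega> in M. \<Theta> \<omega> \<ge> 0"
    and "bdd_above (measure_support (distr M borel \<Theta>))"
    and "\<P>(\<omega> in M. \<Theta> \<omega> = 0) < 1"
    and "indep_elements M borel \<Theta>
           ((\<Pi>\<^sub>M k\<in>{1..n}. borel) \<Otimes>\<^sub>M (\<Pi>\<^sub>M l\<in>{1..n}. borel))
           (\<lambda>\<omega>. (\<lambda>k\<in>{1..n}. X k \<omega>, \<lambda>l\<in>{1..n}. Y l \<omega>))"
    and "\<And>k l. k \<in> {1..n} \<Longrightarrow> l \<in> {1..n} \<Longrightarrow>
           dominatedly_varying2 M (X k) (Y l) \<and> long_tailed2 M (X k) (Y l)"
    and "TAI M n X"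
    and "TAI M n Y"
  shows "(\<lambda>(x, y). \<P>(\<omega> in M. weighted_sum \<Theta> X n \<omega> > x \<and> weighted_sum \<Theta> Y n \<omega> > y))
           \<sim>[at_top \<times>\<^sub>F at_top]
         (\<lambda>(x, y). \<P>(\<omega> in M. (MAX i\<in>{1..n}. weighted_sum \<Theta> X i \<omega>) > x \<and>
                                  (MAX j\<in>{1..n}. weighted_sum \<Theta> Y j \<omega>) > y)) \<and>
         (\<lambda>(x, y). \<P>(\<omega> in M. (MAX i\<in>{1..n}. weighted_sum \<Theta> X i \<omega>) > x \<and>
                                  (MAX j\<in>{1..n}. weighted_sum \<Theta> Y j \<omega>) > y))
           \<sim>[at_top \<times>\<^sub>F at_top]
         (\<lambda>(x, y). \<P>(\<omega> in M. (MAX k\<in>{1..n}. \<Theta> \<omega> * X k \<omega>) > x \<and>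
                                  (MAX l\<in>{1..n}. \<Theta> \<omega> * Y l \<omega>) > y)) \<and>
         (\<lambda>(x, y). \<P>(\<omega> in M. (MAX k\<in>{1..n}. \<Theta> \<omega> * X k \<omega>) > x \<and>
                                  (MAX l\<in>{1..n}. \<Theta> \<omega> * Y l \<omega>) > y))
           \<sim>[at_top \<times>\<^sub>F at_top]
         (\<lambda>(x, y). \<Sum>k=1..n. \<Sum>l=1..n. \<P>(\<omega> in M. \<Theta> \<omega> * X k \<omega> > x \<and> \<Theta> \<omega> * Y l \<omega> > y))"
proof -
  interpret prob_space M by fact
  interpret gtai_vectors M X Y n n
    using assms by unfold_locales auto
  have \<Theta> [measurable]: "\<Theta> \<in> borel_measurable M" by fact
  obtain c where c: "\<And>t. t \<in> measure_support (distr M borel \<Theta>) \<Longrightarrow> t \<le> c"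
    using assms(15) by (auto simp: bdd_above_def)
  have "AE \<omega> in M. \<Theta> \<omega> \<in> measure_support (distr M borel \<Theta>)"
    using AE_in_measure_support[of "distr M borel \<Theta>"] by (auto dest!: AE_distrD[OF \<Theta>])
  with assms(14) have bounded: "AE \<omega> in M. 0 \<le> \<Theta> \<omega> \<and> \<Theta> \<omega> \<le> c"
    by eventually_elim (auto intro: c)
  \<comment> \<open>\<open>U\<close> and \<open>V\<close> need to agree with \<open>\<Theta>\<close> times the functional only where \<open>\<Theta> \<ge> 0\<close>: pulling \<open>\<Theta>\<close> out of a maximum requires it.\<close>
  have one_jump: "(\<lambda>(x, y). joint_tail M U V x y) \<sim>[at_top \<times>\<^sub>F at_top]
      (\<lambda>(x, y). \<Sum>k=1..n. \<Sum>l=1..n. joint_tail M (\<lambda>\<omega>. \<Theta> \<omega> * X k \<omega>) (\<lambda>\<omega>. \<Theta> \<omega> * Y l \<omega>) x y)"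
    if h: "one_jump_functional n h"
      and [measurable]: "U \<in> borel_measurable M" "V \<in> borel_measurable M"
      and U: "\<And>\<omega>. \<Theta> \<omega> \<ge> 0 \<Longrightarrow> U \<omega> = \<Theta> \<omega> * h (\<lambda>k\<in>{1..n}. X k \<omega>)"
      and V: "\<And>\<omega>. \<Theta> \<omega> \<ge> 0 \<Longrightarrow> V \<omega> = \<Theta> \<omega> * h (\<lambda>l\<in>{1..n}. Y l \<omega>)"
    for h U V
  proof -
    have hm: "h \<in> borel_measurable (\<Pi>\<^sub>M k\<in>{1..n}. borel)"
      using h by (simp add: one_jump_functional_def)
    have hX: "(\<lambda>\<omega>. h (\<lambda>k\<in>{1..n}. X k \<omega>)) \<in> borel_measurable M"
      by (rule measurable_compose[OF _ hm]) (auto intro!: measurable_restrict)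
    have hY: "(\<lambda>\<omega>. h (\<lambda>l\<in>{1..n}. Y l \<omega>)) \<in> borel_measurable M"
      by (rule measurable_compose[OF _ hm]) (auto intro!: measurable_restrict)
    have "joint_tail M U V x y = joint_tail M (\<lambda>\<omega>. \<Theta> \<omega> * h (\<lambda>k\<in>{1..n}. X k \<omega>))
        (\<lambda>\<omega>. \<Theta> \<omega> * h (\<lambda>l\<in>{1..n}. Y l \<omega>)) x y" for x y
    proof (rule joint_tail_cong_AE)
      show "AE \<omega> in M. U \<omega> = \<Theta> \<omega> * h (\<lambda>k\<in>{1..n}. X k \<omega>) \<and> V \<omega> = \<Theta> \<omega> * h (\<lambda>l\<in>{1..n}. Y l \<omega>)"
        using assms(14) by eventually_elim (simp add: U V)
    qed (use hX hY in measurable)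
    then show ?thesis
      using joint_tail_one_jump_functional[OF assms(17) \<Theta> bounded h h] by simp
  qed
  have sum_meas [measurable]: "weighted_sum \<Theta> X i \<in> borel_measurable M"
    "weighted_sum \<Theta> Y i \<in> borel_measurable M" if "i \<in> {1..n}" for i
    using that unfolding weighted_sum_def[abs_def]
    by (auto intro!: borel_measurable_sum borel_measurable_times)
  have sum_restrict: "weighted_sum \<Theta> W i \<omega> = \<Theta> \<omega> * (\<Sum>k=1..i. (\<lambda>k\<in>{1..n}. W k \<omega>) k)"
    if "i \<in> {1..n}" for W i \<omega>
    using that by (auto simp: weighted_sum_def sum_distrib_left intro!: sum.cong)
  have Max_sums: "(MAX i\<in>{1..n}. weighted_sum \<Theta> W i \<omega>)
      = \<Theta> \<omega> * (MAX i\<in>{1..n}. \<Sum>k=1..i. (\<lambda>k\<in>{1..n}. W k \<omega>) k)" if "\<Theta> \<omega> \<ge> 0" for W \<omega>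
    using that \<open>n \<ge> 1\<close>
    by (subst Max_mult_left[symmetric])
      (auto simp del: restrict_apply simp: sum_restrict intro!: arg_cong[where f = Max] image_cong)
  let ?E = "\<lambda>(x, y). \<Sum>k=1..n. \<Sum>l=1..n.
    joint_tail M (\<lambda>\<omega>. \<Theta> \<omega> * X k \<omega>) (\<lambda>\<omega>. \<Theta> \<omega> * Y l \<omega>) x y"
  have sums: "(\<lambda>(x, y). joint_tail M (weighted_sum \<Theta> X n) (weighted_sum \<Theta> Y n) x y)
      \<sim>[at_top \<times>\<^sub>F at_top] ?E"
    using \<open>n \<ge> 1\<close> by (intro one_jump[OF one_jump_functional_sum]) (auto simp: sum_restrict)
  have max_sums: "(\<lambda>(x, y). joint_tail M (\<lambda>\<omega>. MAX i\<in>{1..n}. weighted_sum \<Theta> X i \<omega>)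
      (\<lambda>\<omega>. MAX j\<in>{1..n}. weighted_sum \<Theta> Y j \<omega>) x y) \<sim>[at_top \<times>\<^sub>F at_top] ?E"
  proof (rule one_jump[OF one_jump_functional_Max_sums[OF \<open>n \<ge> 1\<close>]])
    show "(\<lambda>\<omega>. MAX i\<in>{1..n}. weighted_sum \<Theta> X i \<omega>) \<in> borel_measurable M"
      "(\<lambda>\<omega>. MAX j\<in>{1..n}. weighted_sum \<Theta> Y j \<omega>) \<in> borel_measurable M"
      by (auto intro!: borel_measurable_Max sum_meas)
  qed (rule Max_sums, assumption)+
  have maxima: "(\<lambda>(x, y). joint_tail M (\<lambda>\<omega>. MAX k\<in>{1..n}. \<Theta> \<omega> * X k \<omega>)
      (\<lambda>\<omega>. MAX l\<in>{1..n}. \<Theta> \<omega> * Y l \<omega>) x y) \<sim>[at_top \<times>\<^sub>F at_top] ?E"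
    using \<open>n \<ge> 1\<close>
    by (intro one_jump[OF one_jump_functional_Max[OF \<open>n \<ge> 1\<close>]] borel_measurable_Max)
      (auto simp: Max_mult_left)
  show ?thesis
    using asymp_equiv_trans[OF sums asymp_equiv_symI[OF max_sums]]
      asymp_equiv_trans[OF max_sums asymp_equiv_symI[OF maxima]] maxima
    unfolding joint_tail_def by blast
qed

end
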